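(* Let $F$ and $H$ be $r$-regular non-isomorphic cospectral graphs. Then for every graph $G$: (a) $F\veebar G$ and $H\veebar G$ are $\{A,Q,L\}$NICS; (b) $F\underset{=}{\vee}G$ and $H\underset{=}{\vee}G$ are $\{A,Q,L\}$NICS.
   Context: Graphs are finite, undirected and simple. $A(G)$ is the adjacency matrix, $D(G)$ the diagonal matrix of vertex degrees, $L(G)=D(G)-A(G)$ the Laplacian, $Q(G)=D(G)+A(G)$ the signless Laplacian. For $X\in\{A,L,Q\}$ the $X$-spectrum of $G$ is the multiset of eigenvalues of $X(G)$; two graphs are $X$-cospectral if they have the same $X$-spectrum. For a set $S$ of such matrix types, two graphs are $S$NICS if they are non-isomorphic and $X$-cospectral for every $X\in S$. Two regular graphs are called cospectral if they have the same adjacency spectrum (for regular graphs this is equivalent to being $L$-cospectral or $Q$-cospectral). For vertex-disjoint graphs $G_1$ (with $V(G_1)=\{u_1,\dots,u_{n}\}$) and $G_2$, the join $G_1\vee G_2$ is the disjoint union together with all edges between $V(G_1)$ and $V(G_2)$. The NS (Neighbors Splitting) join $G_1\veebar G_2$ is obtained from $G_1\vee G_2$ by adding new vertices $u_1',\dots,u_{n}'$ and joining $u_i'$ to $u_j$ if and only if $u_iu_j\in E(G_1)$. The NNS (Non Neighbors Splitting) join $G_1\underset{=}{\vee}G_2$ is obtained from $G_1\vee G_2$ by adding new vertices $u_1',\dots,u_{n}'$ and joining $u_i'$ to $u_j$ if and only if $i\ne j$ and $u_iu_j\notin E(G_1)$. *)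

theory Defs
  imports
    "Graph_Theory.Pair_Digraph"
    "Graph_Theory.Digraph_Isomorphism"
    "Jordan_Normal_Form.Char_Poly"
begin

text \<open>
  A finite simple undirected graph is a \<^locale>\<open>pair_graph\<close>: a finite vertex set with a finite,
  symmetric, irreflexive arc relation. An undirected edge is a pair of opposite arcs, so the
  degree of a vertex is its out-degree.
\<close>

definition isomorphic :: "'a pair_pre_digraph \<Rightarrow> 'b pair_pre_digraph \<Rightarrow> bool" where
  "isomorphic G H \<longleftrightarrow> digraph_iso (with_proj G) (with_proj H)"

lemma isomorphic_iff:
  assumes "pair_graph G" "pair_graph H"
  shows "isomorphic G H \<longleftrightarrow>
    (\<exists>f. bij_betw f (pverts G) (pverts H) \<and>
      (\<forall>u\<in>pverts G. \<forall>v\<in>pverts G. (u, v) \<in> parcs G \<longleftrightarrow> (f u, f v) \<in> parcs H))"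
proof -
  interpret G: pair_graph G by fact
  interpret H: pair_graph H by fact
  show ?thesis
  proof
    assume "isomorphic G H"
    then obtain h where h: "G.digraph_isomorphism h" and H: "with_proj H = app_iso h (with_proj G)"
      by (auto simp: isomorphic_def digraph_iso_def)
    let ?f = "iso_verts h"
    have th: "iso_tail h = fst" "iso_head h = snd"
      using arg_cong[OF H, of tail] arg_cong[OF H, of head] by auto
    have V: "pverts H = ?f ` pverts G" and A: "parcs H = iso_arcs h ` parcs G"
      using arg_cong[OF H, of verts] arg_cong[OF H, of arcs] by auto
    have inj: "inj_on ?f (pverts G)"
      using h by (auto simp: G.digraph_isomorphism_def)
    have arc: "iso_arcs h (u, v) = (?f u, ?f v)" if "(u, v) \<in> parcs G" for u v
      using h that th by (force simp: G.digraph_isomorphism_def prod_eq_iff)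
    have "(u, v) \<in> parcs G \<longleftrightarrow> (?f u, ?f v) \<in> parcs H"
      if uv: "u \<in> pverts G" "v \<in> pverts G" for u v
    proof
      assume "(u, v) \<in> parcs G"
      then show "(?f u, ?f v) \<in> parcs H" using A arc[of u v] by force
    next
      assume "(?f u, ?f v) \<in> parcs H"
      then obtain a b where ab: "(a, b) \<in> parcs G" "(?f u, ?f v) = iso_arcs h (a, b)"
        using A by auto
      with arc have "?f u = ?f a" "?f v = ?f b" by auto
      with inj uv G.wellformed'[OF ab(1)] have "u = a" "v = b"
        by (auto dest: inj_onD)
      with ab show "(u, v) \<in> parcs G" by simp
    qed
    then show "\<exists>f. bij_betw f (pverts G) (pverts H) \<and>
      (\<forall>u\<in>pverts G. \<forall>v\<in>pverts G. (u, v) \<in> parcs G \<longleftrightarrow> (f u, f v) \<in> parcs H)"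
      using inj V by (intro exI[of _ ?f]) (auto simp: bij_betw_def)
  next
    assume "\<exists>f. bij_betw f (pverts G) (pverts H) \<and>
      (\<forall>u\<in>pverts G. \<forall>v\<in>pverts G. (u, v) \<in> parcs G \<longleftrightarrow> (f u, f v) \<in> parcs H)"
    then obtain f where b: "bij_betw f (pverts G) (pverts H)"
      and e: "\<And>u v. u \<in> pverts G \<Longrightarrow> v \<in> pverts G \<Longrightarrow> (u, v) \<in> parcs G \<longleftrightarrow> (f u, f v) \<in> parcs H"
      by blast
    define h where "h = \<lparr>iso_verts = f, iso_arcs = map_prod f f,
      iso_head = (snd :: 'b \<times> 'b \<Rightarrow> 'b), iso_tail = fst\<rparr>"
    have inj: "inj_on f (pverts G)" and im: "f ` pverts G = pverts H"
      using b by (auto simp: bij_betw_def)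
    have "inj_on (map_prod f f) (parcs G)"
    proof (rule inj_onI)
      fix x y assume "x \<in> parcs G" "y \<in> parcs G" "map_prod f f x = map_prod f f y"
      then show "x = y" using inj
        by (cases x; cases y) (auto dest: inj_onD G.wellformed')
    qed
    then have h: "G.digraph_isomorphism h"
      using inj G.wf_digraph_axioms by (auto simp: G.digraph_isomorphism_def h_def)
    have "map_prod f f ` parcs G = parcs H"
    proof
      show "map_prod f f ` parcs G \<subseteq> parcs H"
      proof
        fix x assume "x \<in> map_prod f f ` parcs G"
        then obtain a b where ab: "(a, b) \<in> parcs G" "x = (f a, f b)" by auto
        with e G.wellformed'[OF ab(1)] show "x \<in> parcs H" by simp
      qed
      show "parcs H \<subseteq> map_prod f f ` parcs G"
      proof
        fix x assume x: "x \<in> parcs H"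
        obtain c d where [simp]: "x = (c, d)" by (cases x)
        from x have "c \<in> pverts H" "d \<in> pverts H" by (simp_all add: H.wellformed')
        then obtain a b where ab: "a \<in> pverts G" "b \<in> pverts G" "c = f a" "d = f b"
          unfolding im[symmetric] by blast
        with e[of a b] x have "(a, b) \<in> parcs G" by simp
        then have "map_prod f f (a, b) \<in> map_prod f f ` parcs G" by (rule imageI)
        with ab show "x \<in> map_prod f f ` parcs G" by simp
      qed
    qed
    then have "with_proj H = app_iso h (with_proj G)"
      using im by (simp add: app_iso_def h_def with_proj_def)
    with h show "isomorphic G H" by (auto simp: isomorphic_def digraph_iso_def)
  qed
qed

definition regular_graph :: "nat \<Rightarrow> 'a pair_pre_digraph \<Rightarrow> bool" where
  "regular_graph r G \<longleftrightarrow> (\<forall>v\<in>pverts G. out_degree (with_proj G) v = r)"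


text \<open>
  The matrices of a graph are written with respect to a list \<open>vs\<close> enumerating its vertex set.
\<close>

definition adjacency_mat :: "'a pair_pre_digraph \<Rightarrow> 'a list \<Rightarrow> real mat" where
  "adjacency_mat G vs =
    mat (length vs) (length vs) (\<lambda>(i, j). if (vs ! i, vs ! j) \<in> parcs G then 1 else 0)"

definition degree_mat :: "'a pair_pre_digraph \<Rightarrow> 'a list \<Rightarrow> real mat" where
  "degree_mat G vs =
    mat (length vs) (length vs)
      (\<lambda>(i, j). if i = j then real (out_degree (with_proj G) (vs ! i)) else 0)"

datatype matrix_type = Adjacency | Laplacian | Signless_Laplacian

fun graph_mat :: "matrix_type \<Rightarrow> 'a pair_pre_digraph \<Rightarrow> 'a list \<Rightarrow> real mat" where
  "graph_mat Adjacency G vs = adjacency_mat G vs"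
| "graph_mat Laplacian G vs = degree_mat G vs - adjacency_mat G vs"
| "graph_mat Signless_Laplacian G vs = degree_mat G vs + adjacency_mat G vs"

definition is_enumeration :: "'a pair_pre_digraph \<Rightarrow> 'a list \<Rightarrow> bool" where
  "is_enumeration G vs \<longleftrightarrow> distinct vs \<and> set vs = pverts G"

text \<open>
  Eigenvalues with multiplicity: the roots of the characteristic polynomial, taken over the complex
  numbers so that none is lost by definition (the matrices are symmetric, so all are real).
\<close>

definition eigenvalues_mset :: "real mat \<Rightarrow> complex multiset" where
  "eigenvalues_mset M = proots (char_poly (map_mat complex_of_real M))"

text \<open>
  The choice of the enumeration is irrelevant, see \<open>graph_spectrum_eq\<close> below.
\<close>

definition graph_spectrum :: "matrix_type \<Rightarrow> 'a pair_pre_digraph \<Rightarrow> complex multiset" where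
  "graph_spectrum X G = eigenvalues_mset (graph_mat X G (SOME vs. is_enumeration G vs))"

lemma set_eigenvalues_mset:
  assumes "M \<in> carrier_mat n n"
  shows "set_mset (eigenvalues_mset M) = {k. eigenvalue (map_mat complex_of_real M) k}"
proof -
  have c: "map_mat complex_of_real M \<in> carrier_mat n n" using assms by simp
  have "char_poly (map_mat complex_of_real M) \<noteq> 0"
    using degree_monic_char_poly[OF c] by auto
  then show ?thesis
    by (simp add: eigenvalues_mset_def eigenvalue_root_char_poly[OF c])
qed

lemma size_eigenvalues_mset:
  assumes "M \<in> carrier_mat n n"
  shows "size (eigenvalues_mset M) = n"
  using degree_monic_char_poly[of "map_mat complex_of_real M" n] assms
  by (simp add: eigenvalues_mset_def size_proots_complex)

lemma graph_mat_carrier: "graph_mat X G vs \<in> carrier_mat (length vs) (length vs)"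
  by (cases X) (auto simp: adjacency_mat_def degree_mat_def)

lemma similar_mat_permute:
  fixes A B :: "'a :: field mat"
  assumes A: "A \<in> carrier_mat n n" and B: "B \<in> carrier_mat n n"
    and p: "bij_betw p {..<n} {..<n}"
    and AB: "\<And>i j. i < n \<Longrightarrow> j < n \<Longrightarrow> A $$ (i, j) = B $$ (p i, p j)"
  shows "similar_mat A B"
proof -
  define P where "P = mat n n (\<lambda>(i, j). if p i = j then 1 else 0 :: 'a)"
  define Q where "Q = mat n n (\<lambda>(i, j). if p j = i then 1 else 0 :: 'a)"
  have pn: "p i < n" if "i < n" for i using p that by (auto simp: bij_betw_def)
  have inj: "p i = p j \<longleftrightarrow> i = j" if "i < n" "j < n" for i j
    using p that by (auto simp: bij_betw_def inj_on_def)
  have PQ: "P * Q = 1\<^sub>m n"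
    by (rule eq_matI)
      (auto simp: P_def Q_def scalar_prod_def inj pn if_distrib[of "\<lambda>x. x * _"] cong: if_cong)
  have QP: "Q * P = 1\<^sub>m n"
    using mat_mult_left_right_inverse[OF _ _ PQ] by (auto simp: P_def Q_def)
  have PB: "P * B = mat n n (\<lambda>(i, j). B $$ (p i, j))"
    using B by (intro eq_matI)
      (auto simp: P_def scalar_prod_def pn if_distrib[of "\<lambda>x. x * _"] cong: if_cong)
  have "A = P * B * Q"
    unfolding PB using A by (intro eq_matI)
      (auto simp: Q_def scalar_prod_def pn AB if_distrib[of "\<lambda>x. _ * x"] cong: if_cong)
  then show ?thesis
    using A B PQ QP by (intro similar_matI[of _ _ P Q n]) (auto simp: P_def Q_def)
qed

lemma eigenvalues_mset_enumeration:
  assumes "is_enumeration G vs" "is_enumeration G ws"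
  shows "eigenvalues_mset (graph_mat X G vs) = eigenvalues_mset (graph_mat X G ws)"
proof -
  let ?n = "length vs"
  have dv: "distinct vs" and dw: "distinct ws" and s: "set vs = set ws"
    using assms by (auto simp: is_enumeration_def)
  have len: "length ws = ?n" using dv dw s by (metis distinct_card)
  have bv: "bij_betw ((!) vs) {..<?n} (set vs)" and bw: "bij_betw ((!) ws) {..<?n} (set ws)"
    using bij_betw_nth[OF dv] bij_betw_nth[OF dw] len by auto
  define p where "p = the_inv_into {..<?n} ((!) ws) \<circ> (!) vs"
  have p: "bij_betw p {..<?n} {..<?n}"
    unfolding p_def using bij_betw_trans[OF bv[unfolded s] bij_betw_the_inv_into[OF bw]] .
  have wp: "ws ! p i = vs ! i" if "i < ?n" for i
    using that bw s nth_mem[OF that]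
    by (auto simp: p_def bij_betw_def intro!: f_the_inv_into_f)
  have pn: "p i < ?n" if "i < ?n" for i using p that by (auto simp: bij_betw_def)
  have inj: "p i = p j \<longleftrightarrow> i = j" if "i < ?n" "j < ?n" for i j
    using p that by (auto simp: bij_betw_def inj_on_def)
  have "similar_mat (map_mat complex_of_real (graph_mat X G vs))
      (map_mat complex_of_real (graph_mat X G ws))"
    using graph_mat_carrier[of X G vs] graph_mat_carrier[of X G ws]
    by (intro similar_mat_permute[where n = ?n and p = p] p)
      (cases X; auto simp: len adjacency_mat_def degree_mat_def pn wp inj)+
  then show ?thesis
    by (simp add: eigenvalues_mset_def char_poly_similar)
qed

lemma graph_spectrum_eq:
  assumes "is_enumeration G vs"
  shows "graph_spectrum X G = eigenvalues_mset (graph_mat X G vs)"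
  unfolding graph_spectrum_def
  using eigenvalues_mset_enumeration[OF someI[of "is_enumeration G"]] assms by blast


definition cospectral :: "matrix_type \<Rightarrow> 'a pair_pre_digraph \<Rightarrow> 'b pair_pre_digraph \<Rightarrow> bool" where
  "cospectral X G H \<longleftrightarrow> graph_spectrum X G = graph_spectrum X H"

definition NICS :: "matrix_type set \<Rightarrow> 'a pair_pre_digraph \<Rightarrow> 'b pair_pre_digraph \<Rightarrow> bool" where
  "NICS S G H \<longleftrightarrow> \<not> isomorphic G H \<and> (\<forall>X\<in>S. cospectral X G H)"


definition graph_join ::
    "'a pair_pre_digraph \<Rightarrow> 'b pair_pre_digraph \<Rightarrow> ('a + 'b) pair_pre_digraph" where
  "graph_join G1 G2 = \<lparr>
    pverts = Inl ` pverts G1 \<union> Inr ` pverts G2,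
    parcs = {(Inl u, Inl v) | u v. (u, v) \<in> parcs G1}
          \<union> {(Inr x, Inr y) | x y. (x, y) \<in> parcs G2}
          \<union> {(Inl u, Inr x) | u x. u \<in> pverts G1 \<and> x \<in> pverts G2}
          \<union> {(Inr x, Inl u) | u x. u \<in> pverts G1 \<and> x \<in> pverts G2}\<rparr>"

text \<open>
  The join of \<open>G1\<close> and \<open>G2\<close> with a new vertex \<open>Inr u\<close> for every vertex \<open>u\<close> of \<open>G1\<close>, which is joined to
  the (old) vertices \<open>v\<close> of \<open>G1\<close> with \<open>(u, v) \<in> R\<close>.
\<close>

definition splitting_join ::
    "'a rel \<Rightarrow> 'a pair_pre_digraph \<Rightarrow> 'b pair_pre_digraph \<Rightarrow> (('a + 'b) + 'a) pair_pre_digraph" where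
  "splitting_join R G1 G2 = \<lparr>
    pverts = Inl ` pverts (graph_join G1 G2) \<union> Inr ` pverts G1,
    parcs = {(Inl x, Inl y) | x y. (x, y) \<in> parcs (graph_join G1 G2)}
          \<union> {(Inr u, Inl (Inl v)) | u v. (u, v) \<in> R}
          \<union> {(Inl (Inl v), Inr u) | u v. (u, v) \<in> R}\<rparr>"

definition NS_join ::
    "'a pair_pre_digraph \<Rightarrow> 'b pair_pre_digraph \<Rightarrow> (('a + 'b) + 'a) pair_pre_digraph" where
  "NS_join G1 G2 = splitting_join (parcs G1) G1 G2"

definition NNS_join ::
    "'a pair_pre_digraph \<Rightarrow> 'b pair_pre_digraph \<Rightarrow> (('a + 'b) + 'a) pair_pre_digraph" where
  "NNS_join G1 G2 = splitting_join
    {(u, v). u \<in> pverts G1 \<and> v \<in> pverts G1 \<and> u \<noteq> v \<and> (u, v) \<notin> parcs G1} G1 G2"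

lemma pair_graphI:
  assumes "finite (pverts G)" "parcs G \<subseteq> pverts G \<times> pverts G"
    and "\<And>u v. (u, v) \<in> parcs G \<Longrightarrow> (v, u) \<in> parcs G" "\<And>u. (u, u) \<notin> parcs G"
  shows "pair_graph G"
proof
  show "finite (parcs G)" using assms(1,2) by (meson finite_SigmaI finite_subset)
  show "symmetric (with_proj G)" using assms(3) by (auto simp: symmetric_def sym_def)
qed (use assms in auto)

lemma pair_graph_join:
  assumes "pair_graph G1" "pair_graph G2"
  shows "pair_graph (graph_join G1 G2)"
proof -
  interpret G1: pair_graph G1 by fact
  interpret G2: pair_graph G2 by fact
  show ?thesis
    by (rule pair_graphI)
      (auto simp: graph_join_def G1.pair_finite_verts G2.pair_finite_verts
        dest: G1.wellformed' G2.wellformed' G1.arcs_symmetric G2.arcs_symmetric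
          G1.pair_no_loops G2.pair_no_loops)
qed

lemma pair_graph_splitting_join:
  assumes "pair_graph G1" "pair_graph G2" "R \<subseteq> pverts G1 \<times> pverts G1"
  shows "pair_graph (splitting_join R G1 G2)"
proof -
  interpret G1: pair_graph G1 by fact
  interpret J: pair_graph "graph_join G1 G2" using assms by (simp add: pair_graph_join)
  have "Inl v \<in> pverts (graph_join G1 G2)" if "v \<in> pverts G1" for v
    using that by (simp add: graph_join_def)
  then show ?thesis
    using assms(3) by (intro pair_graphI)
      (auto simp: splitting_join_def J.pair_finite_verts G1.pair_finite_verts
        dest: J.wellformed' J.arcs_symmetric J.pair_no_loops)
qed

lemma pair_graph_NS_join:
  assumes "pair_graph G1" "pair_graph G2"
  shows "pair_graph (NS_join G1 G2)"
proof -
  interpret G1: pair_graph G1 by fact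
  show ?thesis unfolding NS_join_def
    by (rule pair_graph_splitting_join[OF assms]) (auto dest: G1.wellformed')
qed

lemma pair_graph_NNS_join:
  assumes "pair_graph G1" "pair_graph G2"
  shows "pair_graph (NNS_join G1 G2)"
  unfolding NNS_join_def by (rule pair_graph_splitting_join[OF assms]) auto

end

theory Submission
  imports Defs
begin

text \<open>
  Let \<open>A\<close> be the adjacency matrix of the regular graph \<open>F\<close> and \<open>R\<close> the matrix of the relation that
  joins the new vertices to the old ones. For all but finitely many \<open>x\<close>, two Schur complements reduce
  \<open>det (x I - M)\<close>, for \<open>M\<close> any of the three matrices of the join, to a factor that is the
  same for \<open>F\<close> and \<open>H\<close>, times \<open>det (q A + e J)\<close> with \<open>q\<close> a quadratic polynomial: \<open>R\<^sup>2\<close> is \<open>A\<^sup>2\<close> or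
  \<open>(J - I - A)\<^sup>2 = (A + I)\<^sup>2 + const J\<close>. As \<open>A J = r J\<close>, this is \<open>det (q A) det (I + e / q r J)\<close>, and
  splitting \<open>q\<close> into linear factors expresses \<open>det (q A)\<close> by the characteristic polynomial of \<open>A\<close>.

  Conversely \<open>F\<close> can be recovered from the join: the new vertices are those of least degree, and
  the vertices of \<open>F\<close> are their neighbours. The degree of the new vertices vanishes only if \<open>F\<close> is
  edgeless or complete, where cospectrality already forces \<open>F\<close> and \<open>H\<close> to be isomorphic.
\<close>

section \<open>Determinants of quadratic polynomials in a matrix\<close>

lemma poly_char_poly:
  fixes A :: "'a :: field mat"
  assumes A: "A \<in> carrier_mat n n"
  shows "poly (char_poly A) k = det (k \<cdot>\<^sub>m 1\<^sub>m n - A)"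
proof -
  have "- char_matrix A k = k \<cdot>\<^sub>m 1\<^sub>m n - A"
    using A by (intro eq_matI) (auto simp: char_matrix_def)
  then show ?thesis using char_poly_matrix[OF A] by simp
qed

text \<open>\<open>E\<close> stands for the inverse of \<open>D\<close> times \<open>C\<close>;
  stating this as \<open>D * E = C\<close> keeps inverses out. Right multiplication by a unit lower
  triangular block matrix, of determinant 1, restores \<open>C\<close> from a block upper triangular
  matrix.\<close>

lemma det_four_block_mat_schur_upper:
  fixes A :: "'a :: idom mat"
  assumes A: "A \<in> carrier_mat n n" and B: "B \<in> carrier_mat n m"
    and C: "C \<in> carrier_mat m n" and D: "D \<in> carrier_mat m m"
    and E: "E \<in> carrier_mat m n" and DE: "D * E = C"
  shows "det (four_block_mat A B C D) = det (A - B * E) * det D"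
proof -
  have "four_block_mat (A - B * E) B (0\<^sub>m m n) D * four_block_mat (1\<^sub>m n) (0\<^sub>m n m) E (1\<^sub>m m) =
      four_block_mat ((A - B * E) * 1\<^sub>m n + B * E) ((A - B * E) * 0\<^sub>m n m + B * 1\<^sub>m m)
        (0\<^sub>m m n * 1\<^sub>m n + D * E) (0\<^sub>m m n * 0\<^sub>m n m + D * 1\<^sub>m m)"
    using A B C D E
    by (subst mult_four_block_mat[where ?n1.0 = n and ?n2.0 = m and ?nr1.0 = n and ?nr2.0 = m
          and ?nc1.0 = n and ?nc2.0 = m]) (simp_all add: minus_carrier_mat)
  also have "(A - B * E) * 1\<^sub>m n + B * E = A"
    using A B E by (intro eq_matI) simp_all
  also have "(A - B * E) * 0\<^sub>m n m + B * 1\<^sub>m m = B" using A B E by auto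
  also have "0\<^sub>m m n * 1\<^sub>m n + D * E = C" using C by (simp add: DE)
  also have "0\<^sub>m m n * 0\<^sub>m n m + D * 1\<^sub>m m = D" using D by simp
  finally have eq: "four_block_mat A B C D =
    four_block_mat (A - B * E) B (0\<^sub>m m n) D * four_block_mat (1\<^sub>m n) (0\<^sub>m n m) E (1\<^sub>m m)" ..
  have "det (four_block_mat (A - B * E) B (0\<^sub>m m n) D) = det (A - B * E) * det D"
    using A B D E by (intro det_four_block_mat_lower_left_zero) auto
  moreover have "det (four_block_mat (1\<^sub>m n) (0\<^sub>m n m) E (1\<^sub>m m)) = 1"
    using E by (subst det_four_block_mat_upper_right_zero) auto
  ultimately show ?thesis unfolding eq using A B D E
    by (subst det_mult[where n = "n + m"]) auto
qed

text \<open>The mirror image, clearing the upper right block by means of \<open>A\<close>. Together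
  the two versions evaluate one block determinant in two ways.\<close>

lemma det_four_block_mat_schur_lower:
  fixes A :: "'a :: idom mat"
  assumes A: "A \<in> carrier_mat n n" and B: "B \<in> carrier_mat n m"
    and C: "C \<in> carrier_mat m n" and D: "D \<in> carrier_mat m m"
    and E: "E \<in> carrier_mat n m" and AE: "A * E = B"
  shows "det (four_block_mat A B C D) = det A * det (D - C * E)"
proof -
  have "four_block_mat A (0\<^sub>m n m) C (D - C * E) * four_block_mat (1\<^sub>m n) E (0\<^sub>m m n) (1\<^sub>m m) =
      four_block_mat (A * 1\<^sub>m n + 0\<^sub>m n m * 0\<^sub>m m n) (A * E + 0\<^sub>m n m * 1\<^sub>m m)
        (C * 1\<^sub>m n + (D - C * E) * 0\<^sub>m m n) (C * E + (D - C * E) * 1\<^sub>m m)"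
    using A B C D E
    by (subst mult_four_block_mat[where ?n1.0 = n and ?n2.0 = m and ?nr1.0 = n and ?nr2.0 = m
          and ?nc1.0 = n and ?nc2.0 = m]) (simp_all add: minus_carrier_mat)
  also have "A * 1\<^sub>m n + 0\<^sub>m n m * 0\<^sub>m m n = A" using A by simp
  also have "A * E + 0\<^sub>m n m * 1\<^sub>m m = B" using B by (simp add: AE)
  also have "C * 1\<^sub>m n + (D - C * E) * 0\<^sub>m m n = C" using C D E by auto
  also have "C * E + (D - C * E) * 1\<^sub>m m = D"
    using C D E by (intro eq_matI) auto
  finally have eq: "four_block_mat A B C D =
    four_block_mat A (0\<^sub>m n m) C (D - C * E) * four_block_mat (1\<^sub>m n) E (0\<^sub>m m n) (1\<^sub>m m)" ..
  have "det (four_block_mat A (0\<^sub>m n m) C (D - C * E)) = det A * det (D - C * E)"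
    using A C D E by (intro det_four_block_mat_upper_right_zero) auto
  moreover have "det (four_block_mat (1\<^sub>m n) E (0\<^sub>m m n) (1\<^sub>m m)) = 1"
    using E by (subst det_four_block_mat_lower_left_zero) auto
  ultimately show ?thesis unfolding eq using A C D E
    by (subst det_mult[where n = "n + m"]) auto
qed

definition ones_mat :: "nat \<Rightarrow> nat \<Rightarrow> 'a :: one mat" where
  "ones_mat n m = mat n m (\<lambda>_. 1)"

lemma ones_mat_carrier [simp]: "ones_mat n m \<in> carrier_mat n m"
  by (simp add: ones_mat_def)

lemma ones_mat_index [simp]: "i < n \<Longrightarrow> j < m \<Longrightarrow> ones_mat n m $$ (i, j) = 1"
  by (simp add: ones_mat_def)

lemma ones_mat_dim [simp]: "dim_row (ones_mat n m) = n" "dim_col (ones_mat n m) = m"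
  by (simp_all add: ones_mat_def)

text \<open>The all-ones matrix is a column times a row. Eliminating either diagonal block of the
  same bordered matrix turns the determinant of size \<open>n\<close> into one of size 1.\<close>

lemma det_one_plus_ones_mat:
  fixes c :: "'a :: idom"
  shows "det (1\<^sub>m n + c \<cdot>\<^sub>m ones_mat n n) = 1 + of_nat n * c"
proof -
  define B :: "'a mat" where "B = (- c) \<cdot>\<^sub>m ones_mat n 1"
  let ?C = "ones_mat 1 n :: 'a mat"
  have B: "B \<in> carrier_mat n 1" by (simp add: B_def)
  have "det (four_block_mat (1\<^sub>m n) B ?C (1\<^sub>m 1)) = det (1\<^sub>m n - B * ?C) * det (1\<^sub>m 1 :: 'a mat)"
    using B by (intro det_four_block_mat_schur_upper) auto
  moreover have "det (four_block_mat (1\<^sub>m n) B ?C (1\<^sub>m 1)) = det (1\<^sub>m n :: 'a mat) * det (1\<^sub>m 1 - ?C * B)"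
    using B by (intro det_four_block_mat_schur_lower) auto
  moreover have "1\<^sub>m n - B * ?C = 1\<^sub>m n + c \<cdot>\<^sub>m ones_mat n n"
    by (intro eq_matI) (auto simp: B_def scalar_prod_def)
  moreover have "det (1\<^sub>m 1 - ?C * B) = 1 + of_nat n * c"
    by (subst det_single) (auto simp: B_def scalar_prod_def)
  ultimately show ?thesis by simp
qed

text \<open>The matrix is \<open>a\<close> times the product of \<alpha> I - A and \<beta> I - A,
  and each factor has a value of the characteristic polynomial as its determinant.\<close>

lemma det_quadratic:
  fixes A :: "'a :: field mat"
  assumes A: "A \<in> carrier_mat n n"
  shows "det (a \<cdot>\<^sub>m (A * A) + (- a * (\<alpha> + \<beta>)) \<cdot>\<^sub>m A + (a * \<alpha> * \<beta>) \<cdot>\<^sub>m 1\<^sub>m n) =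
    a ^ n * poly (char_poly A) \<alpha> * poly (char_poly A) \<beta>"
proof -
  have "(\<alpha> \<cdot>\<^sub>m 1\<^sub>m n - A) * (\<beta> \<cdot>\<^sub>m 1\<^sub>m n - A) =
      (\<alpha> \<cdot>\<^sub>m 1\<^sub>m n - A) * (\<beta> \<cdot>\<^sub>m 1\<^sub>m n) - (\<alpha> \<cdot>\<^sub>m 1\<^sub>m n - A) * A"
    using A by (intro mult_minus_distrib_mat) auto
  also have "(\<alpha> \<cdot>\<^sub>m 1\<^sub>m n - A) * A = \<alpha> \<cdot>\<^sub>m 1\<^sub>m n * A - A * A"
    using A by (intro minus_mult_distrib_mat) auto
  also have "\<alpha> \<cdot>\<^sub>m 1\<^sub>m n * A = \<alpha> \<cdot>\<^sub>m A"
    using A by (subst mult_smult_assoc_mat[where n = n and nr = n and nc = n]) auto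
  also have "(\<alpha> \<cdot>\<^sub>m 1\<^sub>m n - A) * (\<beta> \<cdot>\<^sub>m 1\<^sub>m n) = \<beta> \<cdot>\<^sub>m (\<alpha> \<cdot>\<^sub>m 1\<^sub>m n - A)"
    using A by (subst mult_smult_distrib[where n = n and nr = n and nc = n]) auto
  finally have "a \<cdot>\<^sub>m (A * A) + (- a * (\<alpha> + \<beta>)) \<cdot>\<^sub>m A + (a * \<alpha> * \<beta>) \<cdot>\<^sub>m 1\<^sub>m n =
      a \<cdot>\<^sub>m ((\<alpha> \<cdot>\<^sub>m 1\<^sub>m n - A) * (\<beta> \<cdot>\<^sub>m 1\<^sub>m n - A))"
    using A by (intro eq_matI) (auto simp: algebra_simps simp del: index_mult_mat(1))
  moreover have "det ((\<alpha> \<cdot>\<^sub>m 1\<^sub>m n - A) * (\<beta> \<cdot>\<^sub>m 1\<^sub>m n - A)) =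
      det (\<alpha> \<cdot>\<^sub>m 1\<^sub>m n - A) * det (\<beta> \<cdot>\<^sub>m 1\<^sub>m n - A)"
    using A by (intro det_mult) auto
  ultimately show ?thesis
    using A by (simp add: poly_char_poly)
qed

lemma quadratic_factorization:
  fixes a b c :: complex
  assumes "a \<noteq> 0"
  obtains \<alpha> \<beta> where "b = - a * (\<alpha> + \<beta>)" "c = a * \<alpha> * \<beta>"
proof -
  define s where "s = csqrt (b\<^sup>2 - 4 * a * c)"
  have s: "s * s = b * b - 4 * a * c"
    using power2_csqrt[of "b\<^sup>2 - 4 * a * c"] by (simp add: s_def power2_eq_square)
  have "a * ((- b + s) / (2 * a)) * ((- b - s) / (2 * a)) = (b * b - s * s) / (4 * a)"
    using assms by (simp add: field_simps)
  also have "\<dots> = c" using assms by (simp add: s)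
  finally show ?thesis
    using assms by (intro that[of "(- b + s) / (2 * a)" "(- b - s) / (2 * a)"]) (auto simp: field_simps)
qed

text \<open>For the quadratic polynomial \<open>Q\<close> of \<open>A\<close>, the eigenvector
  equation gives Q J = w J, where w is the value of the quadratic at \<open>r\<close>. As w is
  nonzero, Q + e J equals Q (I + (e / w) J), so the perturbation splits off as a factor even when
  \<open>Q\<close> is singular.\<close>

lemma det_quadratic_plus_ones_mat:
  fixes A :: "complex mat"
  assumes A: "A \<in> carrier_mat n n" and AJ: "A * ones_mat n n = r \<cdot>\<^sub>m ones_mat n n"
    and a: "b = - a * (\<alpha> + \<beta>)" "c = a * \<alpha> * \<beta>"
    and q: "a * r\<^sup>2 + b * r + c \<noteq> 0"
  shows "det (a \<cdot>\<^sub>m (A * A) + b \<cdot>\<^sub>m A + c \<cdot>\<^sub>m 1\<^sub>m n + e \<cdot>\<^sub>m ones_mat n n) =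
    a ^ n * poly (char_poly A) \<alpha> * poly (char_poly A) \<beta> * (1 + of_nat n * (e / (a * r\<^sup>2 + b * r + c)))"
proof -
  let ?J = "ones_mat n n :: complex mat"
  define Q where "Q = a \<cdot>\<^sub>m (A * A) + b \<cdot>\<^sub>m A + c \<cdot>\<^sub>m 1\<^sub>m n"
  define w where "w = a * r\<^sup>2 + b * r + c"
  have Q: "Q \<in> carrier_mat n n" using A by (simp add: Q_def)
  have AAJ: "(A * A) * ?J = r\<^sup>2 \<cdot>\<^sub>m ?J"
    using A by (simp add: assoc_mult_mat[where n\<^sub>2 = n and n\<^sub>3 = n and n\<^sub>4 = n] AJ
        mult_smult_distrib[where n = n and nr = n and nc = n] power2_eq_square)
       auto
  have "Q * ?J = a \<cdot>\<^sub>m (A * A) * ?J + b \<cdot>\<^sub>m A * ?J + c \<cdot>\<^sub>m 1\<^sub>m n * ?J"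
    using A unfolding Q_def
    by (simp add: add_mult_distrib_mat[where nr = n and n = n and nc = n])
  also have "\<dots> = w \<cdot>\<^sub>m ?J"
    using A by (simp add: mult_smult_assoc_mat[where n = n and nr = n and nc = n] AJ AAJ)
      (auto simp: w_def)
  finally have QJ: "Q * ?J = w \<cdot>\<^sub>m ?J" .
  have "Q * (1\<^sub>m n + (e / w) \<cdot>\<^sub>m ?J) = Q + e \<cdot>\<^sub>m ?J"
    using Q q by (simp add: mult_add_distrib_mat[where nr = n and n = n and nc = n] QJ
        mult_smult_distrib[where n = n and nr = n and nc = n])
      (auto simp: w_def)
  then have "det (Q + e \<cdot>\<^sub>m ?J) = det Q * det (1\<^sub>m n + (e / w) \<cdot>\<^sub>m ?J)"
    using Q by (metis add_carrier_mat det_mult one_carrier_mat ones_mat_carrier smult_carrier_mat)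
  then show ?thesis
    using det_quadratic[OF A, of a \<alpha> \<beta>] unfolding det_one_plus_ones_mat Q_def w_def a by simp
qed

text \<open>The roots \<alpha> and \<beta> depend on the coefficients only, so the same pair serves
  both matrices, and the determinant sees the matrix only through its characteristic polynomial,
  \<open>n\<close> and \<open>r\<close>.\<close>

lemma det_quadratic_plus_ones_mat_cong:
  fixes A A' :: "complex mat"
  assumes "A \<in> carrier_mat n n" "A' \<in> carrier_mat n n" "char_poly A = char_poly A'"
    and "A * ones_mat n n = r \<cdot>\<^sub>m ones_mat n n" "A' * ones_mat n n = r \<cdot>\<^sub>m ones_mat n n"
    and "a \<noteq> 0" "a * r\<^sup>2 + b * r + c \<noteq> 0"
  shows "det (a \<cdot>\<^sub>m (A * A) + b \<cdot>\<^sub>m A + c \<cdot>\<^sub>m 1\<^sub>m n + e \<cdot>\<^sub>m ones_mat n n) =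
    det (a \<cdot>\<^sub>m (A' * A') + b \<cdot>\<^sub>m A' + c \<cdot>\<^sub>m 1\<^sub>m n + e \<cdot>\<^sub>m ones_mat n n)"
proof -
  obtain \<alpha> \<beta> where "b = - a * (\<alpha> + \<beta>)" "c = a * \<alpha> * \<beta>"
    using quadratic_factorization[OF \<open>a \<noteq> 0\<close>] .
  from det_quadratic_plus_ones_mat[OF assms(1,4) this assms(7)]
    det_quadratic_plus_ones_mat[OF assms(2,5) this assms(7)] assms(3)
  show ?thesis by simp
qed

section \<open>The block matrix of a splitting join\<close>

text \<open>
  The blocks belong to the vertices of \<open>G1\<close>, those of \<open>G2\<close> and the new vertices, in this order. The
  last two are grouped together because they are eliminated first; blocks with \<open>0\<close> rows or columns
  serve to stack matrices.
\<close>

definition splitting_mat :: "'a \<Rightarrow> 'a \<Rightarrow> 'a \<Rightarrow> 'a mat \<Rightarrow> 'a mat \<Rightarrow> 'a :: comm_ring_1 mat \<Rightarrow> 'a mat" where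
  "splitting_mat s \<delta> \<kappa> A B R =
    (let n = dim_row A; m = dim_row B in
      four_block_mat (\<delta> \<cdot>\<^sub>m 1\<^sub>m n + s \<cdot>\<^sub>m A)
        (four_block_mat (s \<cdot>\<^sub>m ones_mat n m) (s \<cdot>\<^sub>m R) (0\<^sub>m 0 m) (0\<^sub>m 0 n))
        (four_block_mat (s \<cdot>\<^sub>m ones_mat m n) (0\<^sub>m m 0) (s \<cdot>\<^sub>m R) (0\<^sub>m n 0))
        (four_block_mat B (0\<^sub>m m n) (0\<^sub>m n m) (\<kappa> \<cdot>\<^sub>m 1\<^sub>m n)))"

lemma splitting_mat_carrier:
  assumes "A \<in> carrier_mat n n" "B \<in> carrier_mat m m"
  shows "splitting_mat s \<delta> \<kappa> A B R \<in> carrier_mat (n + (m + n)) (n + (m + n))"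
  using assms by (auto simp: splitting_mat_def Let_def)

text \<open>\<open>Y\<close> is the inverse of \<open>B\<close>, built from the adjugate, applied to
  the all-ones matrix, and \<open>t\<close> is the sum of all entries of that inverse. Used with x I
  - B in place of \<open>B\<close>, this \<open>t\<close> is the coronal of \<open>B\<close> at x:
  the only trace that \<open>G2\<close> leaves in the Schur complement.\<close>

lemma resolvent_ones_mat:
  fixes B :: "'a :: field mat"
  assumes B: "B \<in> carrier_mat m m" and det: "det B \<noteq> 0"
  obtains Y t where "Y \<in> carrier_mat m n" "B * Y = ones_mat m n"
    "ones_mat n m * Y = t \<cdot>\<^sub>m ones_mat n n"
proof -
  define P where "P = (1 / det B) \<cdot>\<^sub>m adj_mat B"
  have P: "P \<in> carrier_mat m m" using adj_mat(1)[OF B] by (simp add: P_def)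
  have BP: "B * P = 1\<^sub>m m"
    using adj_mat(1,2)[OF B] B det
    by (simp add: P_def mult_smult_distrib[where n = m and nr = m and nc = m])
      (auto intro!: eq_matI)
  show ?thesis
  proof
    show "P * ones_mat m n \<in> carrier_mat m n" using P by simp
    have "B * (P * ones_mat m n) = (B * P) * ones_mat m n"
      using B P by (intro assoc_mult_mat[symmetric]) auto
    then show "B * (P * ones_mat m n) = ones_mat m n"
      by (simp add: BP left_mult_one_mat[OF ones_mat_carrier])
    show "ones_mat n m * (P * ones_mat m n) = (\<Sum>k<m. \<Sum>l<m. P $$ (k, l)) \<cdot>\<^sub>m ones_mat n n"
      using P by (intro eq_matI) (auto simp: scalar_prod_def lessThan_atLeast0)
  qed
qed

text \<open>The vertices of \<open>G2\<close> and the new vertices are mutually nonadjacent, so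
  their joint block is block diagonal and can be eliminated in one Schur complement. What remains is
  a quadratic in \<open>A\<close> plus a multiple of J: the term \<open>t\<close> comes from
  \<open>G2\<close>, the term in R R from the new vertices.\<close>

lemma poly_char_poly_splitting_mat:
  fixes A B R :: "'a :: field mat"
  assumes A: "A \<in> carrier_mat n n" and B: "B \<in> carrier_mat m m" and R: "R \<in> carrier_mat n n"
    and RR: "R * R = A * A + b \<cdot>\<^sub>m A + c \<cdot>\<^sub>m 1\<^sub>m n + e \<cdot>\<^sub>m ones_mat n n"
    and s: "s * s = 1" and x: "x \<noteq> \<kappa>"
    and Y: "Y \<in> carrier_mat m n" "(x \<cdot>\<^sub>m 1\<^sub>m m - B) * Y = ones_mat m n"
      "ones_mat n m * Y = t \<cdot>\<^sub>m ones_mat n n"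
  shows "poly (char_poly (splitting_mat s \<delta> \<kappa> A B R)) x =
    det ((- 1 / (x - \<kappa>)) \<cdot>\<^sub>m (A * A) + (- s - b / (x - \<kappa>)) \<cdot>\<^sub>m A +
      (x - \<delta> - c / (x - \<kappa>)) \<cdot>\<^sub>m 1\<^sub>m n + (- t - e / (x - \<kappa>)) \<cdot>\<^sub>m ones_mat n n) *
    (poly (char_poly B) x * (x - \<kappa>) ^ n)"
proof -
  let ?k = "x - \<kappa>"
  define D where "D = four_block_mat (x \<cdot>\<^sub>m 1\<^sub>m m - B) (0\<^sub>m m n) (0\<^sub>m n m) (?k \<cdot>\<^sub>m 1\<^sub>m n)"
  define N where "N = four_block_mat ((- s) \<cdot>\<^sub>m ones_mat n m) ((- s) \<cdot>\<^sub>m R) (0\<^sub>m 0 m) (0\<^sub>m 0 n)"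
  define C where "C = four_block_mat ((- s) \<cdot>\<^sub>m ones_mat m n) (0\<^sub>m m 0) ((- s) \<cdot>\<^sub>m R) (0\<^sub>m n 0)"
  \<comment> \<open>This solves D E = C blockwise: \<open>Y\<close> replaces the all-ones block
    divided by x I - B, and the scalar block is inverted by dividing by x - \<kappa>.\<close>
  define E where "E = four_block_mat ((- s) \<cdot>\<^sub>m Y) (0\<^sub>m m 0) ((- s / ?k) \<cdot>\<^sub>m R) (0\<^sub>m n 0)"
  define X where "X = x \<cdot>\<^sub>m 1\<^sub>m n - (\<delta> \<cdot>\<^sub>m 1\<^sub>m n + s \<cdot>\<^sub>m A)"
  have X: "X \<in> carrier_mat n n" and D: "D \<in> carrier_mat (m + n) (m + n)"
    and N: "N \<in> carrier_mat n (m + n)" and C: "C \<in> carrier_mat (m + n) n"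
    and E: "E \<in> carrier_mat (m + n) n"
    using A B R Y by (auto simp: X_def D_def N_def C_def E_def)
  have k: "?k \<noteq> 0" using x by simp
  have char: "x \<cdot>\<^sub>m 1\<^sub>m (n + (m + n)) - splitting_mat s \<delta> \<kappa> A B R = four_block_mat X N C D"
    using A B R
    by (intro eq_matI) (auto simp: splitting_mat_def X_def N_def C_def D_def Let_def)
  have "D * E = four_block_mat ((x \<cdot>\<^sub>m 1\<^sub>m m - B) * ((- s) \<cdot>\<^sub>m Y) + 0\<^sub>m m n * ((- s / ?k) \<cdot>\<^sub>m R))
     ((x \<cdot>\<^sub>m 1\<^sub>m m - B) * 0\<^sub>m m 0 + 0\<^sub>m m n * 0\<^sub>m n 0)
     (0\<^sub>m n m * ((- s) \<cdot>\<^sub>m Y) + ?k \<cdot>\<^sub>m 1\<^sub>m n * ((- s / ?k) \<cdot>\<^sub>m R))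
     (0\<^sub>m n m * 0\<^sub>m m 0 + ?k \<cdot>\<^sub>m 1\<^sub>m n * 0\<^sub>m n 0)"
    unfolding D_def E_def using B R Y(1)
    by (subst mult_four_block_mat[where ?n1.0 = m and ?n2.0 = n and ?nr1.0 = m and ?nr2.0 = n
          and ?nc1.0 = n and ?nc2.0 = 0]) (simp_all add: minus_carrier_mat)
  also have "(x \<cdot>\<^sub>m 1\<^sub>m m - B) * ((- s) \<cdot>\<^sub>m Y) = (- s) \<cdot>\<^sub>m ones_mat m n"
    using B Y by (subst mult_smult_distrib[where n = m and nr = m and nc = n])
      (simp_all add: minus_carrier_mat)
  also have "\<dots> + 0\<^sub>m m n * ((- s / ?k) \<cdot>\<^sub>m R) = (- s) \<cdot>\<^sub>m ones_mat m n"
    using R by simp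
  also have "?k \<cdot>\<^sub>m 1\<^sub>m n * ((- s / ?k) \<cdot>\<^sub>m R) = ?k \<cdot>\<^sub>m (1\<^sub>m n * ((- s / ?k) \<cdot>\<^sub>m R))"
    using R by (intro mult_smult_assoc_mat[where n = n and nr = n and nc = n]) simp_all
  also have "\<dots> = (- s) \<cdot>\<^sub>m R"
    using R k by (intro eq_matI) (simp_all add: left_mult_one_mat[where nr = n and nc = n])
  also have "0\<^sub>m n m * ((- s) \<cdot>\<^sub>m Y) + (- s) \<cdot>\<^sub>m R = (- s) \<cdot>\<^sub>m R"
    using R Y by simp
  finally have DE: "D * E = C"
    unfolding C_def using B by (simp add: minus_carrier_mat right_mult_zero_mat[where nr = m and n = m])
  have "N * E = four_block_mat
     ((- s) \<cdot>\<^sub>m ones_mat n m * ((- s) \<cdot>\<^sub>m Y) + (- s) \<cdot>\<^sub>m R * ((- s / ?k) \<cdot>\<^sub>m R))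
     ((- s) \<cdot>\<^sub>m ones_mat n m * 0\<^sub>m m 0 + (- s) \<cdot>\<^sub>m R * 0\<^sub>m n 0)
     (0\<^sub>m 0 m * ((- s) \<cdot>\<^sub>m Y) + 0\<^sub>m 0 n * ((- s / ?k) \<cdot>\<^sub>m R))
     (0\<^sub>m 0 m * 0\<^sub>m m 0 + 0\<^sub>m 0 n * 0\<^sub>m n 0)"
    unfolding N_def E_def using R Y(1)
    by (subst mult_four_block_mat[where ?n1.0 = m and ?n2.0 = n and ?nr1.0 = n and ?nr2.0 = 0
          and ?nc1.0 = n and ?nc2.0 = 0]) simp_all
  also have "\<dots> = (- s) \<cdot>\<^sub>m ones_mat n m * ((- s) \<cdot>\<^sub>m Y) + (- s) \<cdot>\<^sub>m R * ((- s / ?k) \<cdot>\<^sub>m R)"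
    using R Y(1) by (intro eq_matI) simp_all
  \<comment> \<open>Each correction term carries the sign \<open>s\<close> twice, so by s s = 1 it
    is the same for all matrix types.\<close>
  also have "(- s) \<cdot>\<^sub>m ones_mat n m * ((- s) \<cdot>\<^sub>m Y) = t \<cdot>\<^sub>m ones_mat n n"
    using Y s by (simp add: mult_smult_distrib[where n = m and nr = n and nc = n]
        mult_smult_assoc_mat[where n = m and nr = n and nc = n])
      (intro eq_matI; simp add: mult.assoc[symmetric])
  also have "(- s) \<cdot>\<^sub>m R * ((- s / ?k) \<cdot>\<^sub>m R) = (1 / ?k) \<cdot>\<^sub>m (R * R)"
    using R s by (simp add: mult_smult_distrib[where n = n and nr = n and nc = n]
        mult_smult_assoc_mat[where n = n and nr = n and nc = n] del: index_mult_mat)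
      (intro eq_matI; simp add: mult.assoc[symmetric] del: index_mult_mat(1))
  finally have NE: "N * E = t \<cdot>\<^sub>m ones_mat n n + (1 / ?k) \<cdot>\<^sub>m (R * R)" .
  have "X - N * E = (- 1 / ?k) \<cdot>\<^sub>m (A * A) + (- s - b / ?k) \<cdot>\<^sub>m A +
      (x - \<delta> - c / ?k) \<cdot>\<^sub>m 1\<^sub>m n + (- t - e / ?k) \<cdot>\<^sub>m ones_mat n n"
    unfolding NE RR X_def using A k
    by (intro eq_matI) (auto simp: divide_inverse algebra_simps simp del: index_mult_mat(1))
  moreover have "det D = poly (char_poly B) x * ?k ^ n"
    unfolding D_def poly_char_poly[OF B] using B
    by (subst det_four_block_mat_lower_left_zero[where n = m and m = n])
      (simp_all add: minus_carrier_mat)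
  ultimately show ?thesis
    unfolding poly_char_poly[OF splitting_mat_carrier[OF A B]] char
      det_four_block_mat_schur_upper[OF X N C D E DE] by simp
qed

text \<open>The Schur complement formula is valid at all points except the roots of a nonzero
  polynomial \<open>g\<close>; equality outside these already forces the two characteristic
  polynomials to coincide.\<close>

lemma char_poly_splitting_mat_cong:
  fixes A A' B R R' :: "complex mat"
  assumes A: "A \<in> carrier_mat n n" and A': "A' \<in> carrier_mat n n" and B: "B \<in> carrier_mat m m"
    and R: "R \<in> carrier_mat n n" and R': "R' \<in> carrier_mat n n"
    and char: "char_poly A = char_poly A'"
    and AJ: "A * ones_mat n n = r \<cdot>\<^sub>m ones_mat n n"
    and AJ': "A' * ones_mat n n = r \<cdot>\<^sub>m ones_mat n n"
    and RR: "R * R = A * A + b \<cdot>\<^sub>m A + c \<cdot>\<^sub>m 1\<^sub>m n + e \<cdot>\<^sub>m ones_mat n n"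
    and RR': "R' * R' = A' * A' + b \<cdot>\<^sub>m A' + c \<cdot>\<^sub>m 1\<^sub>m n + e \<cdot>\<^sub>m ones_mat n n"
    and s: "s * s = 1"
  shows "char_poly (splitting_mat s \<delta> \<kappa> A B R) = char_poly (splitting_mat s \<delta> \<kappa> A' B R')"
proof -
  let ?p = "char_poly (splitting_mat s \<delta> \<kappa> A B R)"
  let ?p' = "char_poly (splitting_mat s \<delta> \<kappa> A' B R')"
  \<comment> \<open>This is x - \<kappa> times the value at \<open>r\<close> of the quadratic in the
    Schur complement, with the denominator cleared. It is monic in x, hence nonzero.\<close>
  define w where "w = [:- r\<^sup>2 + s * \<kappa> * r - b * r + \<delta> * \<kappa> - c, - s * r - \<delta> - \<kappa>, 1:]"
  \<comment> \<open>The factors exclude in turn a singular block of new vertices, a singular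
    resolvent of \<open>B\<close>, and a quadratic vanishing at \<open>r\<close>.\<close>
  define g where "g = [:- \<kappa>, 1:] * char_poly B * w"
  have "char_poly B \<noteq> 0" using degree_monic_char_poly[OF B] by auto
  moreover have "w \<noteq> 0" by (simp add: w_def)
  ultimately have g: "g \<noteq> 0" unfolding g_def by (metis mult_eq_0_iff pCons_eq_0_iff one_neq_zero)
  have "poly ?p x = poly ?p' x" if "poly g x \<noteq> 0" for x
  proof -
    have x: "x \<noteq> \<kappa>" "det (x \<cdot>\<^sub>m 1\<^sub>m m - B) \<noteq> 0" and "poly w x \<noteq> 0"
      using that by (auto simp: g_def poly_char_poly[OF B])
    define k where "k = x - \<kappa>"
    have k: "k \<noteq> 0" using x by (simp add: k_def)
    have "poly w x = k * (- 1 / k * r\<^sup>2 + (- s - b / k) * r + (x - \<delta> - c / k))"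
      using k unfolding w_def by (simp add: field_simps) (simp add: k_def algebra_simps)
    with \<open>poly w x \<noteq> 0\<close> have q: "- 1 / k * r\<^sup>2 + (- s - b / k) * r + (x - \<delta> - c / k) \<noteq> 0"
      by auto
    have "x \<cdot>\<^sub>m 1\<^sub>m m - B \<in> carrier_mat m m" using B by (simp add: minus_carrier_mat)
    then obtain Y t where Y: "Y \<in> carrier_mat m n" "(x \<cdot>\<^sub>m 1\<^sub>m m - B) * Y = ones_mat m n"
      "ones_mat n m * Y = t \<cdot>\<^sub>m ones_mat n n"
      using resolvent_ones_mat[OF _ x(2)] by blast
    show ?thesis
      unfolding poly_char_poly_splitting_mat[OF A B R RR s x(1) Y]
        poly_char_poly_splitting_mat[OF A' B R' RR' s x(1) Y] k_def[symmetric]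
      using det_quadratic_plus_ones_mat_cong[OF A A' char AJ AJ' _ q] k by simp
  qed
  \<comment> \<open>Multiplying by \<open>g\<close> makes the difference vanish at the excluded
    points as well.\<close>
  then have "poly ((?p - ?p') * g) x = 0" for x by (cases "poly g x = 0") auto
  then have "(?p - ?p') * g = 0" using poly_all_0_iff_0 by blast
  with g show ?thesis by simp
qed

section \<open>Recovering a graph from its splitting join\<close>

lemma out_degree_eq_card: "out_degree (with_proj G) v = card {w. (v, w) \<in> parcs G}"
proof -
  have "out_arcs (with_proj G) v = Pair v ` {w. (v, w) \<in> parcs G}"
    by (auto simp: out_arcs_def)
  then show ?thesis by (simp add: out_degree_def card_image inj_on_def)
qed

lemma parcs_splitting_join:
  "(Inl (Inl u), Inl (Inl v)) \<in> parcs (splitting_join R G1 G2) \<longleftrightarrow> (u, v) \<in> parcs G1"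
  "(Inl (Inr x), Inl (Inr y)) \<in> parcs (splitting_join R G1 G2) \<longleftrightarrow> (x, y) \<in> parcs G2"
  "(Inl (Inl u), Inl (Inr x)) \<in> parcs (splitting_join R G1 G2) \<longleftrightarrow> u \<in> pverts G1 \<and> x \<in> pverts G2"
  "(Inl (Inr x), Inl (Inl u)) \<in> parcs (splitting_join R G1 G2) \<longleftrightarrow> u \<in> pverts G1 \<and> x \<in> pverts G2"
  "(Inr u, Inl (Inl v)) \<in> parcs (splitting_join R G1 G2) \<longleftrightarrow> (u, v) \<in> R"
  "(Inl (Inl v), Inr u) \<in> parcs (splitting_join R G1 G2) \<longleftrightarrow> (u, v) \<in> R"
  "(Inr u, Inl (Inr x)) \<notin> parcs (splitting_join R G1 G2)"
  "(Inl (Inr x), Inr u) \<notin> parcs (splitting_join R G1 G2)"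
  "(Inr u, Inr v) \<notin> parcs (splitting_join R G1 G2)"
  by (auto simp: splitting_join_def graph_join_def)

lemma pverts_splitting_join:
  "Inl (Inl u) \<in> pverts (splitting_join R G1 G2) \<longleftrightarrow> u \<in> pverts G1"
  "Inl (Inr x) \<in> pverts (splitting_join R G1 G2) \<longleftrightarrow> x \<in> pverts G2"
  "Inr u \<in> pverts (splitting_join R G1 G2) \<longleftrightarrow> u \<in> pverts G1"
  by (auto simp: splitting_join_def graph_join_def)

lemma out_degree_splitting_join:
  assumes G1: "pair_graph G1" and G2: "pair_graph G2"
    and R: "R \<subseteq> pverts G1 \<times> pverts G1" "sym R"
  shows "v \<in> pverts G1 \<Longrightarrow> out_degree (with_proj (splitting_join R G1 G2)) (Inl (Inl v)) =
      out_degree (with_proj G1) v + card (pverts G2) + card {w. (v, w) \<in> R}"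
    and "x \<in> pverts G2 \<Longrightarrow> out_degree (with_proj (splitting_join R G1 G2)) (Inl (Inr x)) =
      out_degree (with_proj G2) x + card (pverts G1)"
    and "out_degree (with_proj (splitting_join R G1 G2)) (Inr v) = card {w. (v, w) \<in> R}"
proof -
  interpret G1: pair_graph G1 by fact
  interpret G2: pair_graph G2 by fact
  let ?P = "parcs (splitting_join R G1 G2)"
  have fin: "finite {w. (v, w) \<in> parcs G1}" "finite {w. (v, w) \<in> R}" for v
    by (rule finite_subset[OF _ G1.pair_finite_verts]; use R in \<open>auto dest: G1.wellformed'\<close>)+
  have fin2: "finite {w. (x, w) \<in> parcs G2}" for x
    by (rule finite_subset[OF _ G2.pair_finite_verts]) (auto dest: G2.wellformed')
  \<comment> \<open>Neighbourhoods can now be compared separately on the three sorts of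
    vertices.\<close>
  have all: "(\<forall>z :: ('a + 'b) + 'a. Q z) \<longleftrightarrow>
      (\<forall>u. Q (Inl (Inl u))) \<and> (\<forall>x. Q (Inl (Inr x))) \<and> (\<forall>u. Q (Inr u))" for Q
    by (metis (full_types) sum.exhaust)
  {
    assume "v \<in> pverts G1"
    then have "{w. (Inl (Inl v), w) \<in> ?P} = (Inl \<circ> Inl) ` {w. (v, w) \<in> parcs G1} \<union>
        ((Inl \<circ> Inr) ` pverts G2 \<union> Inr ` {w. (v, w) \<in> R})"
      using R(2) unfolding set_eq_iff all
      by (auto simp: parcs_splitting_join image_iff dest: symD)
    then show "out_degree (with_proj (splitting_join R G1 G2)) (Inl (Inl v)) =
      out_degree (with_proj G1) v + card (pverts G2) + card {w. (v, w) \<in> R}"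
      using fin[of v] G2.pair_finite_verts unfolding out_degree_eq_card
      by (simp, subst card_Un_disjoint, simp_all, blast, subst card_Un_disjoint)
        (auto simp: card_image inj_on_def)
  }
  {
    assume "x \<in> pverts G2"
    then have "{w. (Inl (Inr x), w) \<in> ?P} = (Inl \<circ> Inr) ` {w. (x, w) \<in> parcs G2} \<union>
        (Inl \<circ> Inl) ` pverts G1"
      unfolding set_eq_iff all by (auto simp: parcs_splitting_join image_iff)
    then show "out_degree (with_proj (splitting_join R G1 G2)) (Inl (Inr x)) =
      out_degree (with_proj G2) x + card (pverts G1)"
      using fin2[of x] G1.pair_finite_verts unfolding out_degree_eq_card
      by (simp, subst card_Un_disjoint) (auto simp: card_image inj_on_def)
  }
  have "{w. (Inr v, w) \<in> ?P} = (Inl \<circ> Inl) ` {w. (v, w) \<in> R}"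
    unfolding set_eq_iff all by (auto simp: parcs_splitting_join image_iff)
  then show "out_degree (with_proj (splitting_join R G1 G2)) (Inr v) = card {w. (v, w) \<in> R}"
    unfolding out_degree_eq_card by (simp add: card_image inj_on_def)
qed

lemma out_degree_graph_iso:
  assumes G: "pair_graph G" and f: "bij_betw f (pverts G) (pverts H)"
    and H: "pair_graph H"
    and arc: "\<And>u v. u \<in> pverts G \<Longrightarrow> v \<in> pverts G \<Longrightarrow> (u, v) \<in> parcs G \<longleftrightarrow> (f u, f v) \<in> parcs H"
    and v: "v \<in> pverts G"
  shows "out_degree (with_proj H) (f v) = out_degree (with_proj G) v"
proof -
  interpret G: pair_graph G by fact
  interpret H: pair_graph H by fact
  have "{w. (f v, w) \<in> parcs H} = f ` {w. (v, w) \<in> parcs G}"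
  proof (intro equalityI subsetI)
    fix w assume w: "w \<in> {w. (f v, w) \<in> parcs H}"
    then have "w \<in> f ` pverts G" using f by (auto simp: bij_betw_def dest: H.wellformed')
    with w arc v show "w \<in> f ` {w. (v, w) \<in> parcs G}" by auto
  qed (use arc v in \<open>auto dest: G.wellformed'\<close>)
  moreover have "inj_on f {w. (v, w) \<in> parcs G}"
    using f by (auto simp: bij_betw_def intro: inj_on_subset dest: G.wellformed')
  ultimately show ?thesis by (simp add: out_degree_eq_card card_image)
qed

text \<open>New vertices have degree exactly \<open>k\<close>. A vertex of \<open>G1\<close> has
  degree at least r + k, which exceeds \<open>k\<close> because r is positive; a vertex of
  \<open>G2\<close> is adjacent to all of \<open>G1\<close>, which has more than \<open>k\<close>
  vertices.\<close>

lemma new_vertex_iff_out_degree: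
  assumes G1: "pair_graph G1" and G2: "pair_graph G2"
    and R: "R \<subseteq> pverts G1 \<times> pverts G1" "sym R"
    and k: "\<forall>v\<in>pverts G1. card {w. (v, w) \<in> R} = k" "k < card (pverts G1)"
    and r: "regular_graph r G1" "r > 0"
    and z: "z \<in> pverts (splitting_join R G1 G2)"
  shows "(\<exists>u. z = Inr u) \<longleftrightarrow> out_degree (with_proj (splitting_join R G1 G2)) z = k"
proof -
  note deg = out_degree_splitting_join[OF G1 G2 R(1,2)]
  consider u where "z = Inl (Inl u)" "u \<in> pverts G1" | x where "z = Inl (Inr x)" "x \<in> pverts G2"
    | u where "z = Inr u" "u \<in> pverts G1"
    using z by (metis pverts_splitting_join sum.exhaust)
  then show ?thesis
    using r k by cases (simp_all add: deg regular_graph_def)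
qed

text \<open>New vertices are adjacent only to vertices of \<open>G1\<close>, and as \<open>k\<close>
  is positive each vertex of \<open>G1\<close> has a new neighbour. The right-hand side speaks of
  degrees and arcs alone, so every isomorphism respects it.\<close>

lemma old_vertex_iff_out_degree:
  assumes G1: "pair_graph G1" and G2: "pair_graph G2"
    and R: "R \<subseteq> pverts G1 \<times> pverts G1" "sym R"
    and k: "\<forall>v\<in>pverts G1. card {w. (v, w) \<in> R} = k" "k < card (pverts G1)" "k > 0"
    and r: "regular_graph r G1" "r > 0"
    and z: "z \<in> pverts (splitting_join R G1 G2)"
  shows "(\<exists>u. z = Inl (Inl u)) \<longleftrightarrow> (\<exists>w\<in>pverts (splitting_join R G1 G2).
    out_degree (with_proj (splitting_join R G1 G2)) w = k \<and> (z, w) \<in> parcs (splitting_join R G1 G2))"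
    (is "_ \<longleftrightarrow> ?R")
proof -
  have "?R \<longleftrightarrow> (\<exists>u. Inr u \<in> pverts (splitting_join R G1 G2) \<and> (z, Inr u) \<in> parcs (splitting_join R G1 G2))"
    using new_vertex_iff_out_degree[OF G1 G2 R k(1,2) r] by blast
  also have "\<dots> \<longleftrightarrow> (\<exists>u. z = Inl (Inl u))"
  proof
    assume "\<exists>u. Inr u \<in> pverts (splitting_join R G1 G2) \<and> (z, Inr u) \<in> parcs (splitting_join R G1 G2)"
    then show "\<exists>u. z = Inl (Inl u)" by (metis parcs_splitting_join(8,9) sum.exhaust)
  next
    assume "\<exists>u. z = Inl (Inl u)"
    then obtain v where v: "z = Inl (Inl v)" ..
    with z have "v \<in> pverts G1" by (simp add: pverts_splitting_join)
    with k have "{w. (v, w) \<in> R} \<noteq> {}" by (metis card.empty less_irrefl)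
    then obtain u where "(u, v) \<in> R" using R(2) by (auto dest: symD)
    then show "\<exists>u. Inr u \<in> pverts (splitting_join R G1 G2) \<and> (z, Inr u) \<in> parcs (splitting_join R G1 G2)"
      using v R(1) by (auto simp: parcs_splitting_join pverts_splitting_join)
  qed
  finally show ?thesis by blast
qed

text \<open>An isomorphism of the joins maps the copy of \<open>F\<close> onto the copy of
  \<open>H\<close>; its restriction is the isomorphism sought, since a splitting join induces the
  original graph on that copy.\<close>

lemma isomorphic_splitting_joinD:
  fixes F :: "'a pair_pre_digraph" and H :: "'b pair_pre_digraph" and G :: "'c pair_pre_digraph"
  assumes F: "pair_graph F" and H: "pair_graph H" and G: "pair_graph G"
    and RF: "RF \<subseteq> pverts F \<times> pverts F" "sym RF"
    and RH: "RH \<subseteq> pverts H \<times> pverts H" "sym RH"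
    and kF: "\<forall>v\<in>pverts F. card {w. (v, w) \<in> RF} = k" "k < card (pverts F)"
    and kH: "\<forall>v\<in>pverts H. card {w. (v, w) \<in> RH} = k" "k < card (pverts H)"
    and k: "k > 0" and rF: "regular_graph r F" and rH: "regular_graph r H" and r: "r > 0"
    and iso: "isomorphic (splitting_join RF F G) (splitting_join RH H G)"
  shows "isomorphic F H"
proof -
  let ?F = "splitting_join RF F G" and ?H = "splitting_join RH H G"
  have pF: "pair_graph ?F" and pH: "pair_graph ?H"
    using pair_graph_splitting_join F H G RF(1) RH(1) by blast+
  obtain f where f: "bij_betw f (pverts ?F) (pverts ?H)"
    and arc: "\<And>u v. u \<in> pverts ?F \<Longrightarrow> v \<in> pverts ?F \<Longrightarrow> (u, v) \<in> parcs ?F \<longleftrightarrow> (f u, f v) \<in> parcs ?H"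
    using iso unfolding isomorphic_iff[OF pF pH] by blast
  have inj: "inj_on f (pverts ?F)" and im: "f ` pverts ?F = pverts ?H"
    using f by (auto simp: bij_betw_def)
  note deg = out_degree_graph_iso[OF pF f pH arc]
  have old: "(\<exists>u. z = Inl (Inl u)) \<longleftrightarrow> (\<exists>v. f z = Inl (Inl v))" if z: "z \<in> pverts ?F" for z
  proof -
    have fz: "f z \<in> pverts ?H" using z im by blast
    have "(\<exists>w\<in>pverts ?H. out_degree (with_proj ?H) w = k \<and> (f z, w) \<in> parcs ?H) \<longleftrightarrow>
      (\<exists>w\<in>pverts ?F. out_degree (with_proj ?F) w = k \<and> (z, w) \<in> parcs ?F)"
      unfolding im[symmetric] using deg arc[OF z] by auto
    then show ?thesis
      using old_vertex_iff_out_degree[OF F G RF kF k rF r z]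
        old_vertex_iff_out_degree[OF H G RH kH k rH r fz] by argo
  qed
  have "\<forall>u\<in>pverts F. \<exists>v\<in>pverts H. f (Inl (Inl u)) = Inl (Inl v)"
    using old im by (metis imageI pverts_splitting_join(1))
  then obtain g where g: "\<And>u. u \<in> pverts F \<Longrightarrow> g u \<in> pverts H"
    "\<And>u. u \<in> pverts F \<Longrightarrow> f (Inl (Inl u)) = Inl (Inl (g u))"
    by metis
  have "bij_betw g (pverts F) (pverts H)"
  proof (rule bij_betwI')
    fix u v assume uv: "u \<in> pverts F" "v \<in> pverts F"
    show "g u = g v \<longleftrightarrow> u = v"
      using inj_on_eq_iff[OF inj, of "Inl (Inl u)" "Inl (Inl v)"] uv g
      by (simp add: pverts_splitting_join)
  next
    fix v assume "v \<in> pverts H"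
    then have "Inl (Inl v) \<in> f ` pverts ?F" by (simp add: im pverts_splitting_join)
    \<comment> \<open>Surjectivity uses \<open>old\<close> backwards: a preimage of a vertex of
      \<open>H\<close> must lie in the copy of \<open>F\<close>.\<close>
    then obtain z where z: "z \<in> pverts ?F" "Inl (Inl v) = f z" by blast
    with old[OF z(1)] obtain u where "z = Inl (Inl u)" by metis
    with z g show "\<exists>u\<in>pverts F. v = g u" by (auto simp: pverts_splitting_join)
  qed (use g in blast)
  moreover have "(u, v) \<in> parcs F \<longleftrightarrow> (g u, g v) \<in> parcs H"
    if uv: "u \<in> pverts F" "v \<in> pverts F" for u v
    using arc[of "Inl (Inl u)" "Inl (Inl v)"] uv g
    by (simp add: parcs_splitting_join pverts_splitting_join)
  ultimately show ?thesis unfolding isomorphic_iff[OF F H] by blast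
qed

section \<open>The matrices of a splitting join\<close>

text \<open>Over the complex numbers a monic polynomial is the product of the linear factors given
  by its multiset of roots.\<close>

lemma cospectral_imp_char_poly_eq:
  assumes "cospectral Adjacency G H" "is_enumeration G vs" "is_enumeration H ws"
  shows "char_poly (map_mat complex_of_real (adjacency_mat G vs)) =
    char_poly (map_mat complex_of_real (adjacency_mat H ws))" (is "?p = ?q")
proof -
  have c: "map_mat complex_of_real (adjacency_mat K us) \<in> carrier_mat (length us) (length us)" for K us
    by (simp add: adjacency_mat_def)
  have "lead_coeff ?p = 1" "lead_coeff ?q = 1"
    using degree_monic_char_poly[OF c[of G vs]] degree_monic_char_poly[OF c[of H ws]] by auto
  moreover have "proots ?p = proots ?q"
    using assms by (simp add: cospectral_def graph_spectrum_eq eigenvalues_mset_def)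
  ultimately show ?thesis
    using complex_poly_decompose_multiset[of ?p] complex_poly_decompose_multiset[of ?q] by metis
qed

lemma cospectral_imp_length_eq:
  assumes "cospectral X G H" "is_enumeration G vs" "is_enumeration H ws"
  shows "length vs = length ws"
  using assms size_eigenvalues_mset[OF graph_mat_carrier[of X G vs]]
    size_eigenvalues_mset[OF graph_mat_carrier[of X H ws]]
  by (simp add: cospectral_def graph_spectrum_eq)

definition rel_mat :: "'a rel \<Rightarrow> 'a list \<Rightarrow> 'b :: zero_neq_one mat" where
  "rel_mat R vs = mat (length vs) (length vs) (\<lambda>(i, j). if (vs ! i, vs ! j) \<in> R then 1 else 0)"

lemma rel_mat_carrier [simp]: "rel_mat R vs \<in> carrier_mat (length vs) (length vs)"
  by (simp add: rel_mat_def)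

lemma rel_mat_index [simp]:
  "i < length vs \<Longrightarrow> j < length vs \<Longrightarrow> rel_mat R vs $$ (i, j) = (if (vs ! i, vs ! j) \<in> R then 1 else 0)"
  by (simp add: rel_mat_def)

lemma rel_mat_dim [simp]: "dim_row (rel_mat R vs) = length vs" "dim_col (rel_mat R vs) = length vs"
  by (simp_all add: rel_mat_def)

lemma map_mat_adjacency_mat: "map_mat complex_of_real (adjacency_mat G vs) = rel_mat (parcs G) vs"
  by (intro eq_matI) (auto simp: adjacency_mat_def)

lemma sum_nth_rel:
  assumes "distinct vs" "{w. (v, w) \<in> R} \<subseteq> set vs"
  shows "(\<Sum>j = 0..<length vs. if (v, vs ! j) \<in> R then 1 else 0 :: 'b :: semiring_1) =
    of_nat (card {w. (v, w) \<in> R})"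
proof -
  have "(\<Sum>j = 0..<length vs. if (v, vs ! j) \<in> R then 1 else 0 :: 'b) =
      (\<Sum>w\<in>set vs. if (v, w) \<in> R then 1 else 0)"
    using sum.reindex_bij_betw[OF bij_betw_nth[OF assms(1)], of "{0..<length vs}" "set vs"
        "\<lambda>w. if (v, w) \<in> R then 1 else 0"] by (simp add: lessThan_atLeast0)
  also have "\<dots> = (\<Sum>w\<in>{w. (v, w) \<in> R}. 1)"
    using assms(2) by (intro sum.mono_neutral_cong_right) auto
  finally show ?thesis by simp
qed

lemma rel_mat_mult_ones_mat:
  fixes R :: "'a rel"
  assumes "distinct vs" "R \<subseteq> set vs \<times> set vs" "\<forall>v\<in>set vs. card {w. (v, w) \<in> R} = k"
  shows "rel_mat R vs * ones_mat (length vs) (length vs) =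
    (of_nat k :: 'b :: comm_ring_1) \<cdot>\<^sub>m ones_mat (length vs) (length vs)"
proof (rule eq_matI)
  fix i j assume "i < dim_row (of_nat k \<cdot>\<^sub>m ones_mat (length vs) (length vs) :: 'b mat)"
    "j < dim_col (of_nat k \<cdot>\<^sub>m ones_mat (length vs) (length vs) :: 'b mat)"
  then have i: "i < length vs" "j < length vs" by auto
  have "(\<Sum>l = 0..<length vs. if (vs ! i, vs ! l) \<in> R then 1 else 0 :: 'b) = of_nat k"
    using sum_nth_rel[OF assms(1), of "vs ! i" R] assms(2,3) i by auto
  then show "(rel_mat R vs * ones_mat (length vs) (length vs)) $$ (i, j) =
      (of_nat k \<cdot>\<^sub>m ones_mat (length vs) (length vs) :: 'b mat) $$ (i, j)"
    using i by (simp add: scalar_prod_def)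
qed auto

text \<open>Symmetry turns constant row sums into constant column sums, by transposition.\<close>

lemma ones_mat_mult_rel_mat:
  fixes R :: "'a rel"
  assumes "distinct vs" "R \<subseteq> set vs \<times> set vs" "\<forall>v\<in>set vs. card {w. (v, w) \<in> R} = k" "sym R"
  shows "ones_mat (length vs) (length vs) * rel_mat R vs =
    (of_nat k :: 'b :: comm_ring_1) \<cdot>\<^sub>m ones_mat (length vs) (length vs)"
proof -
  let ?J = "ones_mat (length vs) (length vs) :: 'b mat"
  have "transpose_mat (rel_mat R vs :: 'b mat) = rel_mat R vs" "transpose_mat ?J = ?J"
    using assms(4) by (auto intro!: eq_matI dest: symD)
  then have "?J * rel_mat R vs = transpose_mat (rel_mat R vs * ?J)"
    by (simp add: transpose_mult[OF rel_mat_carrier ones_mat_carrier])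
  also have "\<dots> = of_nat k \<cdot>\<^sub>m ?J"
    unfolding rel_mat_mult_ones_mat[OF assms(1-3)] by (intro eq_matI) auto
  finally show ?thesis .
qed

text \<open>Each of the three matrices is \<open>deg_coeff X\<close> times D plus
  \<open>adj_coeff X\<close> times A, which allows a uniform treatment; \<open>adj_coeff X\<close>
  always squares to 1.\<close>

fun deg_coeff :: "matrix_type \<Rightarrow> real" where
  "deg_coeff Adjacency = 0"
| "deg_coeff Laplacian = 1"
| "deg_coeff Signless_Laplacian = 1"

fun adj_coeff :: "matrix_type \<Rightarrow> real" where
  "adj_coeff Adjacency = 1"
| "adj_coeff Laplacian = -1"
| "adj_coeff Signless_Laplacian = 1"

lemma graph_mat_index:
  assumes "i < length vs" "j < length vs"
  shows "graph_mat X G vs $$ (i, j) =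
    (if i = j then deg_coeff X * real (out_degree (with_proj G) (vs ! i)) else 0) +
    adj_coeff X * (if (vs ! i, vs ! j) \<in> parcs G then 1 else 0)"
  using assms by (cases X) (auto simp: adjacency_mat_def degree_mat_def)

text \<open>The order matches the blocks of \<open>splitting_mat\<close>; the spectrum does not
  depend on the enumeration, so this one may be chosen.\<close>

definition splitting_enum :: "'a list \<Rightarrow> 'b list \<Rightarrow> (('a + 'b) + 'a) list" where
  "splitting_enum us xs = map (Inl \<circ> Inl) us @ map (Inl \<circ> Inr) xs @ map Inr us"

lemma is_enumeration_splitting_enum:
  assumes "is_enumeration G1 us" "is_enumeration G2 xs"
  shows "is_enumeration (splitting_join R G1 G2) (splitting_enum us xs)"
  using assms
  by (auto simp: is_enumeration_def splitting_enum_def splitting_join_def graph_join_def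
      distinct_map inj_on_def)

lemma splitting_enum_nth:
  "i < length us \<Longrightarrow> splitting_enum us xs ! i = Inl (Inl (us ! i))"
  "length us \<le> i \<Longrightarrow> i - length us < length xs \<Longrightarrow>
    splitting_enum us xs ! i = Inl (Inr (xs ! (i - length us)))"
  "length us \<le> i \<Longrightarrow> length xs \<le> i - length us \<Longrightarrow> i < length us + (length xs + length us) \<Longrightarrow>
    splitting_enum us xs ! i = Inr (us ! (i - length us - length xs))"
  by (auto simp: splitting_enum_def nth_append)

text \<open>The diagonal block of \<open>G2\<close> inside the join: every vertex of
  \<open>G2\<close> gains \<open>n\<close> neighbours, which shifts the degree part by
  \<open>n\<close>. Only the number of vertices of \<open>G1\<close> enters, so \<open>F\<close> and
  \<open>H\<close> give the same block.\<close>

definition join_block :: "matrix_type \<Rightarrow> nat \<Rightarrow> 'b pair_pre_digraph \<Rightarrow> 'b list \<Rightarrow> complex mat" where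
  "join_block X n G xs = map_mat complex_of_real (graph_mat X G xs) +
    complex_of_real (deg_coeff X * real n) \<cdot>\<^sub>m 1\<^sub>m (length xs)"

lemma join_block_carrier: "join_block X n G xs \<in> carrier_mat (length xs) (length xs)"
  by (simp add: join_block_def)

text \<open>Regularity of \<open>G1\<close> and the constant row sums of \<open>R\<close> make the
  degree parts of two blocks scalar: vertices of \<open>G1\<close> have degree r +
  \<open>length xs\<close> + k, new vertices degree k.\<close>

lemma graph_mat_splitting_join:
  fixes G1 :: "'a pair_pre_digraph" and G2 :: "'b pair_pre_digraph"
  assumes G1: "pair_graph G1" and G2: "pair_graph G2"
    and R: "R \<subseteq> pverts G1 \<times> pverts G1" "sym R"
    and k: "\<forall>v\<in>pverts G1. card {w. (v, w) \<in> R} = k" and r: "regular_graph r G1"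
    and us: "is_enumeration G1 us" and xs: "is_enumeration G2 xs"
  shows "map_mat complex_of_real (graph_mat X (splitting_join R G1 G2) (splitting_enum us xs)) =
    splitting_mat (complex_of_real (adj_coeff X))
      (complex_of_real (deg_coeff X * real (r + length xs + k)))
      (complex_of_real (deg_coeff X * real k))
      (rel_mat (parcs G1) us) (join_block X (length us) G2 xs) (rel_mat R us)"
    (is "?L = ?R")
proof -
  let ?n = "length us" and ?m = "length xs"
  have set: "set us = pverts G1" "set xs = pverts G2" and d: "distinct us" "distinct xs"
    using us xs by (auto simp: is_enumeration_def)
  have card: "card (pverts G1) = ?n" "card (pverts G2) = ?m"
    using distinct_card[OF d(1)] distinct_card[OF d(2)] set by auto
  have mem: "i < ?n \<Longrightarrow> us ! i \<in> pverts G1" "i < ?m \<Longrightarrow> xs ! i \<in> pverts G2" for i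
    using set nth_mem by blast+
  have len: "length (splitting_enum us xs) = ?n + (?m + ?n)" by (simp add: splitting_enum_def)
  have R_carrier: "?R \<in> carrier_mat (?n + (?m + ?n)) (?n + (?m + ?n))"
    by (rule splitting_mat_carrier) (simp_all add: join_block_carrier)
  have L_carrier: "?L \<in> carrier_mat (?n + (?m + ?n)) (?n + (?m + ?n))"
    using graph_mat_carrier[of X "splitting_join R G1 G2" "splitting_enum us xs"] by (simp add: len)
  have deg: "i < ?n \<Longrightarrow> out_degree (with_proj G1) (us ! i) = r"
    "i < ?n \<Longrightarrow> card {w. (us ! i, w) \<in> R} = k" for i
    using r k mem by (auto simp: regular_graph_def)
  note degs = out_degree_splitting_join[OF G1 G2 R]
  show ?thesis
  proof (rule eq_matI)
    fix i j assume "i < dim_row ?R" "j < dim_col ?R"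
    then have ij: "i < ?n + (?m + ?n)" "j < ?n + (?m + ?n)" using R_carrier by auto
    consider "i < ?n" | "?n \<le> i" "i - ?n < ?m" | "?n \<le> i" "?m \<le> i - ?n" by linarith
    note i = this
    consider "j < ?n" | "?n \<le> j" "j - ?n < ?m" | "?n \<le> j" "?m \<le> j - ?n" by linarith
    note j = this
    have L: "?L $$ (i, j) = complex_of_real (graph_mat X (splitting_join R G1 G2) (splitting_enum us xs) $$ (i, j))"
      using ij by (subst index_map_mat)
        (use graph_mat_carrier[of X "splitting_join R G1 G2" "splitting_enum us xs"] in \<open>auto simp: len\<close>)
    have B: "join_block X ?n G2 xs $$ (a, b) = complex_of_real (
        (if a = b then deg_coeff X * (real (out_degree (with_proj G2) (xs ! a)) + real ?n) else 0) +
        adj_coeff X * (if (xs ! a, xs ! b) \<in> parcs G2 then 1 else 0))" if "a < ?m" "b < ?m" for a b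
      using that graph_mat_carrier[of X G2 xs]
      by (auto simp: join_block_def graph_mat_index algebra_simps)
    have dimB: "dim_row (join_block X ?n G2 xs) = ?m" "dim_col (join_block X ?n G2 xs) = ?m"
      by (simp_all add: join_block_def)
    note entry = L[unfolded graph_mat_index[OF ij[folded len]]]
    from i show "?L $$ (i, j) = ?R $$ (i, j)"
    proof cases
      case 1
      from j show ?thesis
        by cases (use 1 ij in \<open>auto simp: entry splitting_mat_def Let_def splitting_enum_nth
          parcs_splitting_join mem degs deg card dimB dest: symD[OF R(2)]\<close>)
    next
      case 2
      from j show ?thesis
        by cases (use 2 ij in \<open>auto simp: entry splitting_mat_def Let_def splitting_enum_nth
          parcs_splitting_join mem degs deg card dimB B\<close>)
    next
      case 3
      from j show ?thesis
        by cases (use 3 ij in \<open>auto simp: entry splitting_mat_def Let_def splitting_enum_nth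
          parcs_splitting_join mem degs deg card dimB\<close>)
    qed
  qed (use L_carrier R_carrier in auto)
qed

text \<open>Both joins have a \<open>splitting_mat\<close> with equal scalars and the same block for
  \<open>G\<close>, because \<open>F\<close> and \<open>H\<close> share r, k and the number of
  vertices. The squares of the relation matrices must be given by one quadratic with common b, c and
  e.\<close>

lemma cospectral_splitting_join:
  fixes F :: "'a pair_pre_digraph" and H :: "'b pair_pre_digraph" and G :: "'c pair_pre_digraph"
  assumes F: "pair_graph F" and H: "pair_graph H" and G: "pair_graph G"
    and RF: "RF \<subseteq> pverts F \<times> pverts F" "sym RF"
    and RH: "RH \<subseteq> pverts H \<times> pverts H" "sym RH"
    and kF: "\<forall>v\<in>pverts F. card {w. (v, w) \<in> RF} = k"
    and kH: "\<forall>v\<in>pverts H. card {w. (v, w) \<in> RH} = k"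
    and rF: "regular_graph r F" and rH: "regular_graph r H"
    and co: "cospectral Adjacency F H"
    and us: "is_enumeration F us" and vs: "is_enumeration H vs"
    and sqF: "rel_mat RF us * rel_mat RF us = rel_mat (parcs F) us * rel_mat (parcs F) us +
      b \<cdot>\<^sub>m rel_mat (parcs F) us + c \<cdot>\<^sub>m 1\<^sub>m (length us) + e \<cdot>\<^sub>m (ones_mat (length us) (length us) :: complex mat)"
    and sqH: "rel_mat RH vs * rel_mat RH vs = rel_mat (parcs H) vs * rel_mat (parcs H) vs +
      b \<cdot>\<^sub>m rel_mat (parcs H) vs + c \<cdot>\<^sub>m 1\<^sub>m (length vs) + e \<cdot>\<^sub>m (ones_mat (length vs) (length vs) :: complex mat)"
  shows "cospectral X (splitting_join RF F G) (splitting_join RH H G)"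
proof -
  interpret F: pair_graph F by fact
  interpret H: pair_graph H by fact
  interpret G: pair_graph G by fact
  obtain xs where xs: "is_enumeration G xs"
    using finite_distinct_list[OF G.pair_finite_verts] by (auto simp: is_enumeration_def)
  have len: "length vs = length us" using cospectral_imp_length_eq[OF co us vs] by simp
  have char: "char_poly (rel_mat (parcs F) us :: complex mat) = char_poly (rel_mat (parcs H) vs)"
    using cospectral_imp_char_poly_eq[OF co us vs] by (simp add: map_mat_adjacency_mat)
  have JF: "rel_mat (parcs F) us * ones_mat (length us) (length us) =
      (of_nat r :: complex) \<cdot>\<^sub>m ones_mat (length us) (length us)"
    using us rF F.wellformed' by (intro rel_mat_mult_ones_mat)
      (auto simp: is_enumeration_def regular_graph_def out_degree_eq_card)
  have JH: "rel_mat (parcs H) vs * ones_mat (length vs) (length vs) =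
      (of_nat r :: complex) \<cdot>\<^sub>m ones_mat (length vs) (length vs)"
    using vs rH H.wellformed' by (intro rel_mat_mult_ones_mat)
      (auto simp: is_enumeration_def regular_graph_def out_degree_eq_card)
  have s: "complex_of_real (adj_coeff X) * complex_of_real (adj_coeff X) = 1"
    by (cases X) auto
  note carrier = rel_mat_carrier[of "parcs H" vs, unfolded len] rel_mat_carrier[of RH vs, unfolded len]
  have "char_poly (map_mat complex_of_real (graph_mat X (splitting_join RF F G) (splitting_enum us xs))) =
      char_poly (map_mat complex_of_real (graph_mat X (splitting_join RH H G) (splitting_enum vs xs)))"
    unfolding graph_mat_splitting_join[OF F G RF kF rF us xs]
      graph_mat_splitting_join[OF H G RH kH rH vs xs] len
    by (rule char_poly_splitting_mat_cong[OF rel_mat_carrier carrier(1) join_block_carrier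
          rel_mat_carrier carrier(2) char JF JH[unfolded len] sqF sqH[unfolded len] s])
  then show ?thesis
    unfolding cospectral_def
      graph_spectrum_eq[OF is_enumeration_splitting_enum[OF us xs]]
      graph_spectrum_eq[OF is_enumeration_splitting_enum[OF vs xs]]
    by (simp add: eigenvalues_mset_def)
qed

section \<open>Nonadjacency in regular graphs\<close>

text \<open>The arc relation of the complement graph, which is the relation used by
  \<open>NNS_join\<close>.\<close>

definition nonadjacency :: "'a pair_pre_digraph \<Rightarrow> 'a rel" where
  "nonadjacency G = {(u, v). u \<in> pverts G \<and> v \<in> pverts G \<and> u \<noteq> v \<and> (u, v) \<notin> parcs G}"

lemma nonadjacency_subset: "nonadjacency G \<subseteq> pverts G \<times> pverts G"
  by (auto simp: nonadjacency_def)

lemma sym_nonadjacency: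
  assumes "pair_graph G"
  shows "sym (nonadjacency G)"
proof -
  interpret pair_graph G by fact
  show ?thesis by (auto simp: nonadjacency_def sym_def dest: arcs_symmetric)
qed

text \<open>The vertex set splits into \<open>v\<close>, its neighbours and its non-neighbours. The
  additive form avoids truncated subtraction.\<close>

lemma card_nonadjacency:
  assumes G: "pair_graph G" and r: "regular_graph r G" and v: "v \<in> pverts G"
  shows "card {w. (v, w) \<in> nonadjacency G} + Suc r = card (pverts G)"
proof -
  interpret pair_graph G by fact
  let ?N = "{w. (v, w) \<in> nonadjacency G}" and ?A = "{w. (v, w) \<in> parcs G}"
  have eq: "pverts G = insert v (?N \<union> ?A)"
    using v by (auto simp: nonadjacency_def dest: wellformed')
  then have fin: "finite ?N" "finite ?A"
    using pair_finite_verts by (metis finite_Un finite_insert)+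
  have "v \<notin> ?N \<union> ?A" by (auto simp: nonadjacency_def dest: pair_no_loops)
  with fin have "card (insert v (?N \<union> ?A)) = Suc (card (?N \<union> ?A))"
    by (intro card_insert_disjoint finite_UnI)
  also have "insert v (?N \<union> ?A) = pverts G" using eq by (rule sym)
  also have "card (?N \<union> ?A) = card ?N + card ?A"
    by (rule card_Un_disjoint[OF fin]) (auto simp: nonadjacency_def)
  also have "card ?A = r"
    using r v by (simp add: regular_graph_def out_degree_eq_card)
  finally show ?thesis by simp
qed

text \<open>The relation matrix is J - I - A. Expanding one factor at a time leaves only products
  with J that are row or column sums: R J = k J and J A = r J. Collecting the multiples of J gives
  the coefficient k - 1 - r.\<close>

lemma rel_mat_nonadjacency_square:
  assumes G: "pair_graph G" and r: "regular_graph r G" and vs: "is_enumeration G vs"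
    and k: "\<forall>v\<in>pverts G. card {w. (v, w) \<in> nonadjacency G} = k"
  defines "n \<equiv> length vs" and "A \<equiv> rel_mat (parcs G) vs :: 'b :: comm_ring_1 mat"
  shows "rel_mat (nonadjacency G) vs * rel_mat (nonadjacency G) vs =
    A * A + 2 \<cdot>\<^sub>m A + 1 \<cdot>\<^sub>m 1\<^sub>m n + (of_nat k - 1 - of_nat r) \<cdot>\<^sub>m ones_mat n n"
proof -
  interpret pair_graph G by fact
  let ?J = "ones_mat n n :: 'b mat"
  define R where "R = (rel_mat (nonadjacency G) vs :: 'b mat)"
  have set: "set vs = pverts G" and d: "distinct vs" using vs by (auto simp: is_enumeration_def)
  have A: "A \<in> carrier_mat n n" and R: "R \<in> carrier_mat n n"
    by (simp_all add: A_def R_def n_def)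
  have mem: "i < n \<Longrightarrow> vs ! i \<in> pverts G" for i using set nth_mem n_def by blast
  have noloop: "(u, u) \<notin> parcs G" for u by (auto dest: pair_no_loops)
  have RJA: "R = ?J - (1\<^sub>m n + A)"
  proof (rule eq_matI)
    fix i j assume "i < dim_row (?J - (1\<^sub>m n + A))" "j < dim_col (?J - (1\<^sub>m n + A))"
    then have ij: "i < length vs" "j < length vs" using A by (auto simp: n_def)
    then have "vs ! i = vs ! j \<longleftrightarrow> i = j" "vs ! i \<in> pverts G" "vs ! j \<in> pverts G"
      using d mem by (simp_all add: nth_eq_iff_index_eq n_def)
    then show "R $$ (i, j) = (?J - (1\<^sub>m n + A)) $$ (i, j)"
      using ij noloop by (simp add: R_def A_def n_def nonadjacency_def)
  qed (simp_all add: R_def A_def n_def)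
  have JA: "?J * A = of_nat r \<cdot>\<^sub>m ?J"
    unfolding A_def n_def using d r set wellformed' arcs_symmetric
    by (intro ones_mat_mult_rel_mat)
      (auto simp: regular_graph_def out_degree_eq_card sym_def)
  have RJ: "R * ?J = of_nat k \<cdot>\<^sub>m ?J"
    unfolding R_def n_def using d k set nonadjacency_subset
    by (intro rel_mat_mult_ones_mat) auto
  have "R * A = ?J * A - (1\<^sub>m n + A) * A"
    unfolding RJA using A by (intro minus_mult_distrib_mat) auto
  also have "(1\<^sub>m n + A) * A = 1\<^sub>m n * A + A * A"
    using A by (intro add_mult_distrib_mat) auto
  finally have RA: "R * A = of_nat r \<cdot>\<^sub>m ?J - (A + A * A)"
    using A by (simp add: JA)
  have "R * R = R * (?J - (1\<^sub>m n + A))"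
    using RJA by simp
  also have "\<dots> = R * ?J - R * (1\<^sub>m n + A)"
    using R A by (intro mult_minus_distrib_mat) auto
  also have "R * (1\<^sub>m n + A) = R * 1\<^sub>m n + R * A"
    using R A by (intro mult_add_distrib_mat) auto
  also have "R * 1\<^sub>m n = ?J - (1\<^sub>m n + A)"
    using right_mult_one_mat[OF R] RJA by (rule trans)
  finally have "R * R = of_nat k \<cdot>\<^sub>m ?J - (?J - (1\<^sub>m n + A) + (of_nat r \<cdot>\<^sub>m ?J - (A + A * A)))"
    by (simp add: RA RJ)
  also have "\<dots> = A * A + 2 \<cdot>\<^sub>m A + 1 \<cdot>\<^sub>m 1\<^sub>m n + (of_nat k - 1 - of_nat r) \<cdot>\<^sub>m ?J"
    using A by (intro eq_matI) (auto simp: algebra_simps simp del: index_mult_mat(1))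
  finally show ?thesis unfolding R_def .
qed

text \<open>Any bijection preserves equality, hence adjacency. Taking \<open>P\<close> constantly
  false covers edgeless graphs, and \<open>Not\<close> covers complete ones.\<close>

lemma isomorphic_if_arcs_by_equality:
  assumes G: "pair_graph G" and H: "pair_graph H" and card: "card (pverts G) = card (pverts H)"
    and "\<And>u v. u \<in> pverts G \<Longrightarrow> v \<in> pverts G \<Longrightarrow> (u, v) \<in> parcs G \<longleftrightarrow> P (u = v)"
    and "\<And>u v. u \<in> pverts H \<Longrightarrow> v \<in> pverts H \<Longrightarrow> (u, v) \<in> parcs H \<longleftrightarrow> P (u = v)"
  shows "isomorphic G H"
proof -
  interpret G: pair_graph G by fact
  interpret H: pair_graph H by fact
  obtain f where f: "bij_betw f (pverts G) (pverts H)"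
    using finite_same_card_bij[OF G.pair_finite_verts H.pair_finite_verts card] by blast
  have "(u, v) \<in> parcs G \<longleftrightarrow> (f u, f v) \<in> parcs H" if uv: "u \<in> pverts G" "v \<in> pverts G" for u v
  proof -
    have "f u \<in> pverts H" "f v \<in> pverts H" "f u = f v \<longleftrightarrow> u = v"
      using f uv by (auto simp: bij_betw_def inj_on_eq_iff)
    with uv show ?thesis by (simp only: assms(4,5))
  qed
  with f show ?thesis unfolding isomorphic_iff[OF G H] by blast
qed

theorem corollary4p5:
  fixes F :: "'a pair_pre_digraph" and H :: "'b pair_pre_digraph"
    and G :: "'c pair_pre_digraph" and r :: nat
  assumes "pair_graph F" and "pair_graph H"
    and "regular_graph r F" and "regular_graph r H"
    and "\<not> isomorphic F H" and "cospectral Adjacency F H"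
    and "pair_graph G"
  shows "NICS {Adjacency, Signless_Laplacian, Laplacian} (NS_join F G) (NS_join H G)
       \<and> NICS {Adjacency, Signless_Laplacian, Laplacian} (NNS_join F G) (NNS_join H G)"
proof -
  interpret F: pair_graph F by fact
  interpret H: pair_graph H by fact
  note F = \<open>pair_graph F\<close> and H = \<open>pair_graph H\<close> and G = \<open>pair_graph G\<close>
  note rF = \<open>regular_graph r F\<close> and rH = \<open>regular_graph r H\<close>
  note niso = \<open>\<not> isomorphic F H\<close> and co = \<open>cospectral Adjacency F H\<close>
  obtain us where us: "is_enumeration F us"
    using finite_distinct_list[OF F.pair_finite_verts] by (auto simp: is_enumeration_def)
  obtain vs where vs: "is_enumeration H vs"
    using finite_distinct_list[OF H.pair_finite_verts] by (auto simp: is_enumeration_def)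
  define n where "n = card (pverts F)"
  have nH: "card (pverts H) = n"
    using cospectral_imp_length_eq[OF co us vs] us vs
    by (metis distinct_card is_enumeration_def n_def)
  have degF: "\<forall>v\<in>pverts F. card {w. (v, w) \<in> parcs F} = r"
    and degH: "\<forall>v\<in>pverts H. card {w. (v, w) \<in> parcs H} = r"
    using rF rH by (auto simp: regular_graph_def out_degree_eq_card)
  have arcsF: "parcs F \<subseteq> pverts F \<times> pverts F" "sym (parcs F)"
    and arcsH: "parcs H \<subseteq> pverts H \<times> pverts H" "sym (parcs H)"
    using F.wellformed' F.arcs_symmetric H.wellformed' H.arcs_symmetric by (auto simp: sym_def)
  have "finite {w. (v, w) \<in> parcs F}" "finite {w. (v, w) \<in> nonadjacency F}" for v
    by (rule finite_subset[OF _ F.pair_finite_verts]; use arcsF nonadjacency_subset in auto)+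
  moreover have "finite {w. (v, w) \<in> parcs H}" "finite {w. (v, w) \<in> nonadjacency H}" for v
    by (rule finite_subset[OF _ H.pair_finite_verts]; use arcsH nonadjacency_subset in auto)+
  ultimately have fin: "\<And>v. finite {w. (v, w) \<in> parcs F}" "\<And>v. finite {w. (v, w) \<in> parcs H}"
    "\<And>v. finite {w. (v, w) \<in> nonadjacency F}" "\<And>v. finite {w. (v, w) \<in> nonadjacency H}"
    by blast+
  \<comment> \<open>Two graphs without vertices are isomorphic. A vertex is needed to obtain
    \<open>Suc r \<le> n\<close>, which gives the strict bounds on \<open>r\<close> and
    \<open>k\<close> below.\<close>
  have "pverts F \<noteq> {}"
    using isomorphic_if_arcs_by_equality[OF F H, of "\<lambda>_. False"] niso nH H.pair_finite_verts
    by (auto simp: n_def)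
  then have "Suc r \<le> n" using card_nonadjacency[OF F rF] unfolding n_def by fastforce
  define k where "k = n - Suc r"
  have kF: "\<forall>v\<in>pverts F. card {w. (v, w) \<in> nonadjacency F} = k"
    using card_nonadjacency[OF F rF] unfolding k_def n_def by fastforce
  have kH: "\<forall>v\<in>pverts H. card {w. (v, w) \<in> nonadjacency H} = k"
    using card_nonadjacency[OF H rH] unfolding k_def nH by fastforce
  \<comment> \<open>For r = 0 both graphs are edgeless of equal order, hence isomorphic.\<close>
  have r: "r > 0"
  proof (rule ccontr)
    assume "\<not> r > 0"
    with degF degH fin have "isomorphic F H"
      by (intro isomorphic_if_arcs_by_equality[OF F H, of "\<lambda>_. False"]) (auto simp: nH n_def[symmetric])
    with niso show False ..
  qed
  \<comment> \<open>For k = 0 no two distinct vertices are nonadjacent, so both graphs are complete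
    of equal order.\<close>
  have k: "k > 0"
  proof (rule ccontr)
    assume "\<not> k > 0"
    with kF kH fin have "\<forall>v\<in>pverts F. {w. (v, w) \<in> nonadjacency F} = {}"
      "\<forall>v\<in>pverts H. {w. (v, w) \<in> nonadjacency H} = {}" by auto
    then have "isomorphic F H"
      by (intro isomorphic_if_arcs_by_equality[OF F H, of Not])
        (auto simp: nH n_def[symmetric] nonadjacency_def dest: F.pair_no_loops H.pair_no_loops)
    with niso show False ..
  qed
  have lt: "r < n" "k < n" using \<open>Suc r \<le> n\<close> by (auto simp: k_def)
  \<comment> \<open>In the NS join the new vertices have degree \<open>r\<close>, so
    \<open>r\<close> takes the place of \<open>k\<close> in the recovery lemma.\<close>
  have "\<not> isomorphic (NS_join F G) (NS_join H G)"
    using niso isomorphic_splitting_joinD[OF F H G arcsF arcsH degF _ degH _ r rF rH r] lt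
    unfolding NS_join_def by (auto simp: n_def nH[unfolded n_def])
  \<comment> \<open>Here R is A itself, so the correction terms b, c and e of its square are
    0.\<close>
  moreover have "cospectral X (NS_join F G) (NS_join H G)" for X
    unfolding NS_join_def
    by (rule cospectral_splitting_join[OF F H G arcsF arcsH degF degH rF rH co us vs,
          where b = 0 and c = 0 and e = 0]) (auto intro!: eq_matI)
  moreover have NNS: "NNS_join F G = splitting_join (nonadjacency F) F G"
    "NNS_join H G = splitting_join (nonadjacency H) H G"
    by (simp_all add: NNS_join_def nonadjacency_def)
  moreover have "\<not> isomorphic (splitting_join (nonadjacency F) F G) (splitting_join (nonadjacency H) H G)"
    using niso isomorphic_splitting_joinD[OF F H G nonadjacency_subset sym_nonadjacency[OF F]
        nonadjacency_subset sym_nonadjacency[OF H] kF _ kH _ k rF rH r] lt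
    by (auto simp: n_def nH[unfolded n_def])
  moreover have "cospectral X (splitting_join (nonadjacency F) F G) (splitting_join (nonadjacency H) H G)" for X
    by (rule cospectral_splitting_join[OF F H G nonadjacency_subset sym_nonadjacency[OF F]
        nonadjacency_subset sym_nonadjacency[OF H] kF kH rF rH co us vs
        rel_mat_nonadjacency_square[OF F rF us kF] rel_mat_nonadjacency_square[OF H rH vs kH]])
  ultimately show ?thesis by (simp add: NICS_def)
qed

end
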